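(* Let $\alpha>0$ and let $\mathcal{Q}=\{q_y\}_{y\in Y}$ be a family of counting queries on a data universe $\mathcal{X}$ with index set $Y\subseteq\{-1,1\}^m$. If $\mathcal{P}_{t,W}(m)$ $(\alpha/4)$-approximates the restricted function family $\mathcal{F}_{\mathcal{Q}}|_Y$, then the multiplicative weights update rule $\mathbf{U}^{MW}_\alpha$ described below is an iterative database construction for $\mathcal{Q}$ with mistake bound $$B=\frac{16W^2\log\left(2\binom{m}{\le t}+1\right)}{\alpha^2}.$$ Moreover, $\mathbf{U}^{MW}_\alpha$ runs in time $\mathrm{poly}\left(\binom{m}{\le t},\log W,\log(1/\alpha)\right)$.
   Context: Counting query: $q:\mathcal{X}\to\{0,1\}$, $q(D)=\frac1n\sum_i q(x^{(i)})$ for $D=(x^{(1)},\dots,x^{(n)})\in\mathcal{X}^n$. $f_x(y)=q_y(x)$, $\mathcal{F}_{\mathcal{Q}}=\{f_x\}_{x\in\mathcal{X}}$, and $f_D(y)=\frac1n\sum_i f_{x^{(i)}}(y)$. For a polynomial $p(y)=\sum_{S\subseteq[m]}c_S\prod_{i\in S}y_i$, degree is $\max\{|S|:c_S\neq0\}$ and weight is $\sum_S|c_S|$; $\mathcal{P}_{t,W}(m)$ is the set of $m$-variate polynomials of degree $\le t$ and weight $\le W$; it $\gamma$-approximates $\mathcal{F}_{\mathcal{Q}}|_Y$ if for every $x\in\mathcal{X}$ some $p_x\in\mathcal{P}_{t,W}(m)$ satisfies $|p_x(y)-f_x(y)|\le\gamma$ for all $y\in Y$. Let $\binom{[m]}{\le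 t}=\{S\subseteq[m]:|S|\le t\}$ and $N=2\binom{m}{\le t}+1$ where $\binom{m}{\le t}=|\binom{[m]}{\le t}|$. Vectors of length $N$ are indexed by $0$, by $S\in\binom{[m]}{\le t}$, and by $\neg S$ for $S\in\binom{[m]}{\le t}$. To a query $y\in\{-1,1\}^m$ associate $\bar y$ with $\bar y_0=0$, $\bar y_S=\prod_{i\in S}y_i$, $\bar y_{\neg S}=-\prod_{i\in S}y_i$. A hypothesis is a nonnegative vector $\bar p$ of length $N$ with $\|\bar p\|_1=1$, representing the function $y\mapsto W\langle\bar p,\bar y\rangle$. Update rule $\mathbf{U}^{MW}_\alpha$: let $\eta=\alpha/(4W)$. The initial hypothesis is $\bar p^{(1)}=\frac1N(1,\dots,1)$. Given $(\bar p,y,a)$: if $a<W\langle\bar p,\bar y\rangle$ set $r=\bar y$, otherwise $r=-\bar y$; set $\bar p'_I=\exp(-\eta r_I)\bar p_I$ for every index $I$, normalize $\bar p'\leftarrow\bar p'/\|\bar p'\|_1$, and output $\bar p'$. Iterative database construction (IDC): fix any database $D\in\mathcal{X}^n$ and play against an adversary: starting from $\bar p^{(1)}$, in each round $s=1,2,\dots$ the adversary picks $y^{(s)}\in Y$ (possibly depending on the current hypothesis); the algorithm makes a mistake if $|W\langle\bar p^{(s)},\bar y^{(s)}\rangle-f_D(y^{(s)})|>\alpha$; in that case it receives a real $a^{(s)}$ with $|a^{(s)}-f_D(y^{(s)})|\le\alpha/2$ and sets $\bar p^{(s+1)}=\mathbf{U}(\bar p^{(s)},y^{(s)},a^{(s)})$;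 otherwise $\bar p^{(s+1)}=\bar p^{(s)}$. $\mathbf{U}$ is an IDC for $\mathcal{Q}$ with mistake bound $B$ if for every database and every adversary the number of mistake rounds is at most $B$. *)

theory Defs
  imports Complex_Main "HOL-Library.FuncSet" "HOL-Library.Nat_Bijection"
begin

section \<open>Counting queries and databases\<close>

definition counting_query :: "'x set \<Rightarrow> ('x \<Rightarrow> real) \<Rightarrow> bool" where
  "counting_query X q \<longleftrightarrow> q \<in> X \<rightarrow> {0, 1}"

definition query_fun :: "('y \<Rightarrow> 'x \<Rightarrow> real) \<Rightarrow> 'x \<Rightarrow> 'y \<Rightarrow> real" where
  "query_fun q x y = q y x"

definition db_fun :: "('y \<Rightarrow> 'x \<Rightarrow> real) \<Rightarrow> 'x list \<Rightarrow> 'y \<Rightarrow> real" where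
  "db_fun q D y = (\<Sum>x\<leftarrow>D. query_fun q x y) / real (length D)"

definition cube :: "nat \<Rightarrow> (nat \<Rightarrow> real) set" where
  "cube m = {1..m} \<rightarrow>\<^sub>E {-1, 1}"


section \<open>Multilinear polynomials of bounded degree and weight\<close>

text \<open>A polynomial \<open>p(y) = \<Sum>\<^sub>S c\<^sub>S \<Prod>\<^sub>i\<^sub>\<in>\<^sub>S y\<^sub>i\<close> is represented by its coefficient family \<open>c\<close>,
  with \<open>c\<^sub>S = 0\<close> unless \<open>S \<subseteq> [m] = {1..m}\<close>. The zero polynomial has degree \<open>0\<close>.\<close>

definition mpoly_eval :: "nat \<Rightarrow> (nat set \<Rightarrow> real) \<Rightarrow> (nat \<Rightarrow> real) \<Rightarrow> real" where
  "mpoly_eval m c y = (\<Sum>S\<in>Pow {1..m}. c S * (\<Prod>i\<in>S. y i))"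

definition mpoly_degree :: "nat \<Rightarrow> (nat set \<Rightarrow> real) \<Rightarrow> nat" where
  "mpoly_degree m c = Max (insert 0 (card ` {S \<in> Pow {1..m}. c S \<noteq> 0}))"

definition mpoly_weight :: "nat \<Rightarrow> (nat set \<Rightarrow> real) \<Rightarrow> real" where
  "mpoly_weight m c = (\<Sum>S\<in>Pow {1..m}. \<bar>c S\<bar>)"

definition bounded_polys :: "nat \<Rightarrow> real \<Rightarrow> nat \<Rightarrow> (nat set \<Rightarrow> real) set" where
  "bounded_polys t W m =
    {c. (\<forall>S. \<not> S \<subseteq> {1..m} \<longrightarrow> c S = 0) \<and> mpoly_degree m c \<le> t \<and> mpoly_weight m c \<le> W}"

definition approximates ::
  "nat \<Rightarrow> (nat set \<Rightarrow> real) set \<Rightarrow> real \<Rightarrow> 'x set \<Rightarrow> (nat \<Rightarrow> real) set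
    \<Rightarrow> ((nat \<Rightarrow> real) \<Rightarrow> 'x \<Rightarrow> real) \<Rightarrow> bool" where
  "approximates m P \<gamma> X Y q \<longleftrightarrow>
    (\<forall>x\<in>X. \<exists>p\<in>P. \<forall>y\<in>Y. \<bar>mpoly_eval m p y - query_fun q x y\<bar> \<le> \<gamma>)"


section \<open>Iterative database constructions\<close>

text \<open>Hypotheses \<open>h\<close> represent the functions \<open>ev h\<close>. A play consists of the sequences of queries,
  answers and hypotheses of rounds \<open>s = 1, 2, \<dots>\<close>. Since the update rule is deterministic, the plays
  against all (adaptive) adversaries are exactly the plays with arbitrary query and answer
  sequences satisfying the constraints below.\<close>

definition mistake ::
  "('h \<Rightarrow> 'y \<Rightarrow> real) \<Rightarrow> ('y \<Rightarrow> real) \<Rightarrow> real \<Rightarrow> 'h \<Rightarrow> 'y \<Rightarrow> bool" where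
  "mistake ev f \<alpha> h y \<longleftrightarrow> \<bar>ev h y - f y\<bar> > \<alpha>"

definition idc_play ::
  "('h \<Rightarrow> 'y \<Rightarrow> real) \<Rightarrow> 'h \<Rightarrow> ('h \<Rightarrow> 'y \<Rightarrow> real \<Rightarrow> 'h) \<Rightarrow> 'y set \<Rightarrow> ('y \<Rightarrow> real) \<Rightarrow> real
    \<Rightarrow> (nat \<Rightarrow> 'y) \<Rightarrow> (nat \<Rightarrow> real) \<Rightarrow> (nat \<Rightarrow> 'h) \<Rightarrow> bool" where
  "idc_play ev h1 U Y f \<alpha> y a h \<longleftrightarrow>
    h 1 = h1 \<and>
    (\<forall>s\<ge>1. y s \<in> Y \<and>
      (if mistake ev f \<alpha> (h s) (y s)
       then \<bar>a s - f (y s)\<bar> \<le> \<alpha> / 2 \<and> h (Suc s) = U (h s) (y s) (a s)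
       else h (Suc s) = h s))"

definition is_IDC ::
  "('h \<Rightarrow> 'y \<Rightarrow> real) \<Rightarrow> 'h \<Rightarrow> ('h \<Rightarrow> 'y \<Rightarrow> real \<Rightarrow> 'h) \<Rightarrow> 'x set \<Rightarrow> 'y set
    \<Rightarrow> ('y \<Rightarrow> 'x \<Rightarrow> real) \<Rightarrow> real \<Rightarrow> real \<Rightarrow> bool" where
  "is_IDC ev h1 U X Y q \<alpha> B \<longleftrightarrow>
    (\<forall>D y a h. D \<noteq> [] \<longrightarrow> set D \<subseteq> X \<longrightarrow> idc_play ev h1 U Y (db_fun q D) \<alpha> y a h \<longrightarrow>
      finite {s. 1 \<le> s \<and> mistake ev (db_fun q D) \<alpha> (h s) (y s)} \<and>
      real (card {s. 1 \<le> s \<and> mistake ev (db_fun q D) \<alpha> (h s) (y s)}) \<le> B)"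


section \<open>The multiplicative weights update rule\<close>

definition subsets_le :: "nat \<Rightarrow> nat \<Rightarrow> nat set set" where
  "subsets_le m t = {S. S \<subseteq> {1..m} \<and> card S \<le> t}"

definition binom_le :: "nat \<Rightarrow> nat \<Rightarrow> nat" where
  "binom_le m t = card (subsets_le m t)"

text \<open>The coordinates \<open>0\<close>, \<open>S\<close> and \<open>\<not>S\<close>.\<close>

datatype coord = Zero | Pos "nat set" | Neg "nat set"

definition coords :: "nat \<Rightarrow> nat \<Rightarrow> coord set" where
  "coords m t = insert Zero (Pos ` subsets_le m t \<union> Neg ` subsets_le m t)"

definition dimN :: "nat \<Rightarrow> nat \<Rightarrow> nat" where
  "dimN m t = 2 * binom_le m t + 1"

fun ybar :: "(nat \<Rightarrow> real) \<Rightarrow> coord \<Rightarrow> real" where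
  "ybar y Zero = 0"
| "ybar y (Pos S) = (\<Prod>i\<in>S. y i)"
| "ybar y (Neg S) = - (\<Prod>i\<in>S. y i)"

definition dot :: "nat \<Rightarrow> nat \<Rightarrow> (coord \<Rightarrow> real) \<Rightarrow> (coord \<Rightarrow> real) \<Rightarrow> real" where
  "dot m t u v = (\<Sum>I\<in>coords m t. u I * v I)"

definition l1_norm :: "nat \<Rightarrow> nat \<Rightarrow> (coord \<Rightarrow> real) \<Rightarrow> real" where
  "l1_norm m t u = (\<Sum>I\<in>coords m t. \<bar>u I\<bar>)"

definition hypotheses :: "nat \<Rightarrow> nat \<Rightarrow> (coord \<Rightarrow> real) set" where
  "hypotheses m t = {p \<in> coords m t \<rightarrow>\<^sub>E {0..}. l1_norm m t p = 1}"

definition hyp_eval :: "nat \<Rightarrow> nat \<Rightarrow> real \<Rightarrow> (coord \<Rightarrow> real) \<Rightarrow> (nat \<Rightarrow> real) \<Rightarrow> real" where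
  "hyp_eval m t W p y = W * dot m t p (ybar y)"

definition mw_init :: "nat \<Rightarrow> nat \<Rightarrow> coord \<Rightarrow> real" where
  "mw_init m t = (\<lambda>I\<in>coords m t. 1 / real (dimN m t))"

definition mw_update ::
  "nat \<Rightarrow> nat \<Rightarrow> real \<Rightarrow> real \<Rightarrow> (coord \<Rightarrow> real) \<Rightarrow> (nat \<Rightarrow> real) \<Rightarrow> real \<Rightarrow> coord \<Rightarrow> real" where
  "mw_update m t W \<alpha> p y a =
    (let \<eta> = \<alpha> / (4 * W);
         r = (if a < hyp_eval m t W p y then ybar y else (\<lambda>I. - ybar y I));
         p' = (\<lambda>I. exp (- \<eta> * r I) * p I)
     in (\<lambda>I\<in>coords m t. p' I / l1_norm m t p'))"

lemma finite_subsets_le: "finite (subsets_le m t)"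
  unfolding subsets_le_def by (rule finite_subset[of _ "Pow {1..m}"]) auto

lemma card_coords: "card (coords m t) = dimN m t"
proof -
  have "card (Pos ` subsets_le m t \<union> Neg ` subsets_le m t) = 2 * binom_le m t"
    using finite_subsets_le[of m t]
    by (subst card_Un_disjoint) (auto simp: card_image inj_on_def binom_le_def)
  then show ?thesis
    using finite_subsets_le[of m t]
    by (auto simp: coords_def dimN_def card_insert_if)
qed


section \<open>Running time\<close>

text \<open>The update rule manipulates arbitrary real numbers and the exponential function, so its
  running time is measured on a real RAM: an imperative language with finitely many scalar variables
  and one-dimensional arrays, holding natural numbers (used for counters and addresses) or real
  numbers. The only operations on reals are the field operations, \<open>exp\<close>, integer constants, array
  access and comparison; in particular there is no rounding, and no conversion from reals to
  naturals. Variables and arrays are identified by numbers occurring literally in the program.\<close>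

record store =
  nvar :: "nat \<Rightarrow> nat"
  narr :: "nat \<Rightarrow> nat \<Rightarrow> nat"
  rvar :: "nat \<Rightarrow> real"
  rarr :: "nat \<Rightarrow> nat \<Rightarrow> real"

datatype instr =
    NConst nat nat | NAdd nat nat nat | NSub nat nat nat
  | NLoad nat nat nat | NStore nat nat nat
  | RConst nat int | RAdd nat nat nat | RSub nat nat nat | RMul nat nat nat | RDiv nat nat nat
  | RExp nat nat
  | RLoad nat nat nat | RStore nat nat nat

datatype test = NLess nat nat | RLess nat nat

datatype com = Do instr | Seq com com | Cond test com com | While test com

fun run_instr :: "instr \<Rightarrow> store \<Rightarrow> store" where
  "run_instr (NConst x k) s = s\<lparr>nvar := (nvar s)(x := k)\<rparr>"
| "run_instr (NAdd x i j) s = s\<lparr>nvar := (nvar s)(x := nvar s i + nvar s j)\<rparr>"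
| "run_instr (NSub x i j) s = s\<lparr>nvar := (nvar s)(x := nvar s i - nvar s j)\<rparr>"
| "run_instr (NLoad x A i) s = s\<lparr>nvar := (nvar s)(x := narr s A (nvar s i))\<rparr>"
| "run_instr (NStore A i x) s =
    s\<lparr>narr := (narr s)(A := (narr s A)(nvar s i := nvar s x))\<rparr>"
| "run_instr (RConst x k) s = s\<lparr>rvar := (rvar s)(x := of_int k)\<rparr>"
| "run_instr (RAdd x u v) s = s\<lparr>rvar := (rvar s)(x := rvar s u + rvar s v)\<rparr>"
| "run_instr (RSub x u v) s = s\<lparr>rvar := (rvar s)(x := rvar s u - rvar s v)\<rparr>"
| "run_instr (RMul x u v) s = s\<lparr>rvar := (rvar s)(x := rvar s u * rvar s v)\<rparr>"
| "run_instr (RDiv x u v) s = s\<lparr>rvar := (rvar s)(x := rvar s u / rvar s v)\<rparr>"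
| "run_instr (RExp x u) s = s\<lparr>rvar := (rvar s)(x := exp (rvar s u))\<rparr>"
| "run_instr (RLoad x A i) s = s\<lparr>rvar := (rvar s)(x := rarr s A (nvar s i))\<rparr>"
| "run_instr (RStore A i x) s =
    s\<lparr>rarr := (rarr s)(A := (rarr s A)(nvar s i := rvar s x))\<rparr>"

fun run_test :: "test \<Rightarrow> store \<Rightarrow> bool" where
  "run_test (NLess i j) s \<longleftrightarrow> nvar s i < nvar s j"
| "run_test (RLess u v) s \<longleftrightarrow> rvar s u < rvar s v"

text \<open>Operations on naturals cost \<open>1\<close>, operations on reals cost \<open>\<kappa>\<close>.\<close>

fun instr_cost :: "nat \<Rightarrow> instr \<Rightarrow> nat" where
  "instr_cost \<kappa> (NConst x k) = 1"
| "instr_cost \<kappa> (NAdd x i j) = 1"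
| "instr_cost \<kappa> (NSub x i j) = 1"
| "instr_cost \<kappa> (NLoad x A i) = 1"
| "instr_cost \<kappa> (NStore A i x) = 1"
| "instr_cost \<kappa> _ = \<kappa>"

fun test_cost :: "nat \<Rightarrow> test \<Rightarrow> nat" where
  "test_cost \<kappa> (NLess i j) = 1"
| "test_cost \<kappa> (RLess u v) = \<kappa>"

text \<open>\<open>exec \<kappa> c s n s'\<close>: started in \<open>s\<close>, the program \<open>c\<close> terminates in \<open>s'\<close> after time \<open>n\<close>.\<close>

inductive exec :: "nat \<Rightarrow> com \<Rightarrow> store \<Rightarrow> nat \<Rightarrow> store \<Rightarrow> bool" for \<kappa> :: nat where
  Do: "exec \<kappa> (Do i) s (instr_cost \<kappa> i) (run_instr i s)"
| Seq: "exec \<kappa> c s n s' \<Longrightarrow> exec \<kappa> d s' n' s'' \<Longrightarrow> exec \<kappa> (Seq c d) s (n + n') s''"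
| CondTrue: "run_test b s \<Longrightarrow> exec \<kappa> c s n s' \<Longrightarrow>
    exec \<kappa> (Cond b c d) s (test_cost \<kappa> b + n) s'"
| CondFalse: "\<not> run_test b s \<Longrightarrow> exec \<kappa> d s n s' \<Longrightarrow>
    exec \<kappa> (Cond b c d) s (test_cost \<kappa> b + n) s'"
| WhileFalse: "\<not> run_test b s \<Longrightarrow> exec \<kappa> (While b c) s (test_cost \<kappa> b) s"
| WhileTrue: "run_test b s \<Longrightarrow> exec \<kappa> c s n s' \<Longrightarrow> exec \<kappa> (While b c) s' n' s'' \<Longrightarrow>
    exec \<kappa> (While b c) s (test_cost \<kappa> b + n + n') s''"

lemma exec_deterministic:
  assumes "exec \<kappa> c s n s'" and "exec \<kappa> c s k u"
  shows "n = k \<and> s' = u"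
  using assms
proof (induction arbitrary: k u rule: exec.induct)
  case (Do i s)
  then show ?case by (auto elim: exec.cases)
next
  case (Seq c s n s' d n' s'')
  from Seq.prems show ?case by cases (use Seq.IH in blast)
next
  case (CondTrue b s c n s' d)
  from CondTrue.prems show ?case by cases (use CondTrue in blast)+
next
  case (CondFalse b s d n s' c)
  from CondFalse.prems show ?case by cases (use CondFalse in blast)+
next
  case (WhileFalse b s c)
  from WhileFalse.prems show ?case by cases (use WhileFalse in blast)+
next
  case (WhileTrue b s c n s' n' s'')
  from WhileTrue.prems show ?case by cases (use WhileTrue in blast)+
qed

text \<open>In memory, the coordinates are ordered as \<open>0\<close>, then all \<open>S\<close>, then all \<open>\<not>S\<close>, the sets \<open>S\<close> being
  ordered by \<open>\<Sum>\<^sub>i\<^sub>\<in>\<^sub>S 2\<^sup>i\<close>.\<close>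

definition subset_list :: "nat \<Rightarrow> nat \<Rightarrow> nat set list" where
  "subset_list m t = filter (\<lambda>S. S \<in> subsets_le m t) (map set_decode [0..<2 ^ Suc m])"

definition coord_list :: "nat \<Rightarrow> nat \<Rightarrow> coord list" where
  "coord_list m t = Zero # map Pos (subset_list m t) @ map Neg (subset_list m t)"

lemma set_subset_list: "set (subset_list m t) = subsets_le m t"
proof -
  have "S \<in> set_decode ` {0..<2 ^ Suc m}" if "S \<in> subsets_le m t" for S
  proof -
    have S: "S \<subseteq> {..<Suc m}" "finite S"
      using that by (auto simp: subsets_le_def intro: finite_subset)
    have "set_encode S \<le> set_encode {..<Suc m}"
      unfolding set_encode_def using S by (intro sum_mono2) auto
    also have "\<dots> < 2 ^ Suc m"
      unfolding set_encode_def lessThan_atLeast0 by (induction m) auto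
    finally have "set_encode S \<in> {0..<2 ^ Suc m}" by simp
    with S show ?thesis by (metis image_eqI set_encode_inverse)
  qed
  then show ?thesis by (auto simp: subset_list_def)
qed

lemma set_coord_list: "set (coord_list m t) = coords m t"
  by (auto simp: coord_list_def coords_def set_subset_list)

lemma distinct_coord_list: "distinct (coord_list m t)"
proof -
  have "inj set_decode"
    by (rule inj_on_inverseI[of _ set_encode]) simp
  then have "distinct (subset_list m t)"
    unfolding subset_list_def
    by (intro distinct_filter) (auto simp: distinct_map inj_def inj_on_def)
  then show ?thesis
    by (auto simp: coord_list_def distinct_map inj_on_def)
qed

definition mw_input ::
  "nat \<Rightarrow> nat \<Rightarrow> real \<Rightarrow> real \<Rightarrow> (coord \<Rightarrow> real) \<Rightarrow> (nat \<Rightarrow> real) \<Rightarrow> real \<Rightarrow> store" where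
  "mw_input m t W \<alpha> p y a =
    \<lparr>nvar = (\<lambda>_. 0)(0 := m, 1 := t),
     narr = (\<lambda>_ _. 0),
     rvar = (\<lambda>_. 0)(0 := W, 1 := \<alpha>, 2 := a),
     rarr = (\<lambda>_ _. 0)
       (0 := (\<lambda>i. if i \<in> {1..m} then y i else 0),
        1 := (\<lambda>j. if j < dimN m t then p (coord_list m t ! j) else 0))\<rparr>"

definition mw_output :: "nat \<Rightarrow> nat \<Rightarrow> (coord \<Rightarrow> real) \<Rightarrow> store \<Rightarrow> bool" where
  "mw_output m t p s \<longleftrightarrow> (\<forall>j < dimN m t. rarr s 1 j = p (coord_list m t ! j))"

text \<open>\<open>T\<close> is bounded by a polynomial in \<open>binom_le m t\<close>, \<open>log W\<close> and \<open>log (1/\<alpha>)\<close>, where negative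
  logarithms count as \<open>0\<close>.\<close>

definition poly_bounded :: "(nat \<Rightarrow> nat \<Rightarrow> real \<Rightarrow> real \<Rightarrow> nat) \<Rightarrow> bool" where
  "poly_bounded T \<longleftrightarrow>
    (\<exists>(c::real) (k::nat). \<forall>m t W \<alpha>. W > 0 \<longrightarrow> \<alpha> > 0 \<longrightarrow>
      real (T m t W \<alpha>) \<le> c * (1 + real (binom_le m t) + max 0 (ln W) + max 0 (ln (1 / \<alpha>))) ^ k)"

text \<open>A single program has to implement the rule \<open>U\<close> for all values of the parameters. The cost \<open>\<kappa>\<close>
  of one operation on reals may be \<open>1\<close> (unit cost), but also any other polynomially bounded
  quantity, such as the cost of arithmetic on numbers with polynomially many digits.\<close>

definition runs_in_poly_time ::
  "(nat \<Rightarrow> nat \<Rightarrow> real \<Rightarrow> real \<Rightarrow> (coord \<Rightarrow> real) \<Rightarrow> (nat \<Rightarrow> real) \<Rightarrow> real \<Rightarrow> coord \<Rightarrow> real) \<Rightarrow> bool"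
  where
  "runs_in_poly_time U \<longleftrightarrow>
    (\<exists>prog. \<forall>\<kappa>. poly_bounded \<kappa> \<longrightarrow>
      (\<exists>T. poly_bounded T \<and>
        (\<forall>m t W \<alpha>. W > 0 \<longrightarrow> \<alpha> > 0 \<longrightarrow>
          (\<forall>p\<in>hypotheses m t. \<forall>y\<in>cube m. \<forall>a.
            \<exists>n s. exec (\<kappa> m t W \<alpha>) prog (mw_input m t W \<alpha> p y a) n s \<and>
              n \<le> T m t W \<alpha> \<and> mw_output m t (U m t W \<alpha> p y a) s))))"

end

theory Submission
  imports Defs
begin

text \<open>
  The average of the polynomials approximating \<open>f\<^sub>x\<close> for the rows \<open>x\<close> of the database lies in the
  same class, and after splitting its coefficients into positive and negative parts and putting the
  slack \<open>1 - weight / W\<close> on the coordinate \<open>0\<close> it becomes a probability vector \<open>u\<close> with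
  \<open>W \<langle>u, ybar y\<rangle>\<close> within \<open>\<alpha>/4\<close> of the true answer. The potential is the cross entropy of \<open>u\<close>
  relative to the current hypothesis: it starts at \<open>ln N\<close>, stays nonnegative because hypotheses have
  entries at most \<open>1\<close>, and drops by at least \<open>2 \<eta>\<^sup>2\<close> at each mistake, where
  \<open>\<langle>p - u, r\<rangle> > 3 \<alpha> / (4 W) = 3 \<eta>\<close>.

  For the running time, the sets \<open>S\<close> are listed in the required order by the recursion that appends
  to the list for \<open>m\<close> the sets \<open>S \<union> {m + 1}\<close> for all listed \<open>S\<close> with \<open>|S| < t\<close>; keeping the
  cardinality and the monomial of every listed set makes each step a constant number of operations.
\<close>

subsection \<open>The mistake bound\<close>

text \<open>For \<open>x > 0\<close>, \<open>1 + x \<le> exp x\<close> and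
  \<open>(1 + x) * (1 - x + x\<^sup>2) = 1 + x ^ 3 \<ge> 1\<close>, so
  \<open>1 - x + x\<^sup>2\<close> dominates the reciprocal of \<open>exp x\<close>.\<close>

lemma exp_minus_le_quadratic:
  fixes x :: real
  assumes "\<bar>x\<bar> \<le> 1"
  shows "exp (- x) \<le> 1 - x + x\<^sup>2"
proof (cases "x \<le> 0")
  case True
  then show ?thesis using exp_bound[of "- x"] assms by simp
next
  case False
  have "1 \<le> (1 + x) * (1 - x + x\<^sup>2)"
    using False by (simp add: algebra_simps power2_eq_square)
  also have "\<dots> \<le> exp x * (1 - x + x\<^sup>2)"
  proof (rule mult_right_mono)
    show "0 \<le> 1 - x + x\<^sup>2" using assms by (smt (verit) zero_le_power2)
  qed simp
  finally show ?thesis by (simp add: exp_minus field_simps)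
qed

text \<open>The one-step estimate of multiplicative weights. Taking logarithms splits the new cross
  entropy into the old one, the sum of \<open>\<eta> * (u i * r i)\<close>, and \<open>ln Z\<close>.
  The quadratic bound on the exponential makes \<open>Z - 1\<close> at most
  \<open>\<eta>\<^sup>2\<close> minus \<eta> times the inner product of \<open>p\<close> and
  \<open>r\<close>, and \<open>ln Z \<le> Z - 1\<close>.\<close>

lemma cross_entropy_reweight_le:
  fixes p u r :: "'i \<Rightarrow> real"
  assumes fin: "finite A"
    and p: "\<And>i. i \<in> A \<Longrightarrow> p i > 0" "sum p A = 1"
    and u: "\<And>i. i \<in> A \<Longrightarrow> u i \<ge> 0" "sum u A = 1"
    and r: "\<And>i. i \<in> A \<Longrightarrow> \<bar>r i\<bar> \<le> 1"
    and \<eta>: "0 \<le> \<eta>" "\<eta> \<le> 1"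
    and Z: "Z = (\<Sum>i\<in>A. exp (- \<eta> * r i) * p i)"
  shows "(\<Sum>i\<in>A. u i * - ln (exp (- \<eta> * r i) * p i / Z))
    \<le> (\<Sum>i\<in>A. u i * - ln (p i)) - \<eta> * ((\<Sum>i\<in>A. p i * r i) - (\<Sum>i\<in>A. u i * r i)) + \<eta>\<^sup>2"
proof -
  have ne: "A \<noteq> {}" using p(2) by auto
  have Zpos: "Z > 0" unfolding Z using fin ne p(1) by (intro sum_pos) auto
  have "Z \<le> (\<Sum>i\<in>A. (1 - \<eta> * r i + \<eta>\<^sup>2) * p i)"
    unfolding Z
  proof (intro sum_mono mult_right_mono)
    fix i assume i: "i \<in> A"
    have "\<bar>\<eta> * r i\<bar> \<le> 1"
      using r[OF i] \<eta> by (simp add: abs_mult mult_le_one)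
    then have "exp (- \<eta> * r i) \<le> 1 - \<eta> * r i + (\<eta> * r i)\<^sup>2"
      using exp_minus_le_quadratic[of "\<eta> * r i"] by simp
    moreover have "(\<eta> * r i)\<^sup>2 \<le> \<eta>\<^sup>2"
      using r[OF i] by (simp add: power_mult_distrib mult_left_le abs_square_le_1)
    ultimately show "exp (- \<eta> * r i) \<le> 1 - \<eta> * r i + \<eta>\<^sup>2" by simp
    show "0 \<le> p i" using p(1)[OF i] by simp
  qed
  also have "\<dots> = (1 + \<eta>\<^sup>2) * sum p A - \<eta> * (\<Sum>i\<in>A. p i * r i)"
    unfolding sum_distrib_left sum_subtractf[symmetric]
    by (intro sum.cong) (auto simp: algebra_simps)
  finally have Zle: "Z \<le> 1 + (\<eta>\<^sup>2 - \<eta> * (\<Sum>i\<in>A. p i * r i))"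
    using p(2) by simp
  have lnZ: "ln Z \<le> \<eta>\<^sup>2 - \<eta> * (\<Sum>i\<in>A. p i * r i)"
    using ln_le_minus_one[OF Zpos] Zle by simp
  have "(\<Sum>i\<in>A. u i * - ln (exp (- \<eta> * r i) * p i / Z))
      = (\<Sum>i\<in>A. u i * - ln (p i) + \<eta> * (u i * r i) + ln Z * u i)"
  proof (rule sum.cong)
    fix i assume i: "i \<in> A"
    have "ln (exp (- \<eta> * r i) * p i / Z) = - \<eta> * r i + ln (p i) - ln Z"
      using p(1)[OF i] Zpos by (simp add: ln_div ln_mult)
    then show "u i * - ln (exp (- \<eta> * r i) * p i / Z)
        = u i * - ln (p i) + \<eta> * (u i * r i) + ln Z * u i"
      by (simp only:) (simp add: algebra_simps)
  qed simp
  also have "\<dots> = (\<Sum>i\<in>A. u i * - ln (p i)) + \<eta> * (\<Sum>i\<in>A. u i * r i) + ln Z * sum u A"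
    by (simp only: sum.distrib sum_distrib_left)
  finally show ?thesis using lnZ u(2) by (simp add: algebra_simps)
qed

section \<open>Approximating polynomials as distributions over the coordinates\<close>

lemma finite_coords: "finite (coords m t)"
  using finite_subsets_le[of m t] by (simp add: coords_def)

lemma sum_coords:
  "(\<Sum>I\<in>coords m t. f I) = f Zero + (\<Sum>S\<in>subsets_le m t. f (Pos S) + f (Neg S))"
proof -
  have "(\<Sum>I\<in>coords m t. f I) = f Zero + sum f (Pos ` subsets_le m t \<union> Neg ` subsets_le m t)"
    unfolding coords_def using finite_subsets_le[of m t] by (subst sum.insert) auto
  also have "sum f (Pos ` subsets_le m t \<union> Neg ` subsets_le m t)
      = sum f (Pos ` subsets_le m t) + sum f (Neg ` subsets_le m t)"
    using finite_subsets_le[of m t] by (intro sum.union_disjoint) auto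
  also have "\<dots> = (\<Sum>S\<in>subsets_le m t. f (Pos S) + f (Neg S))"
    by (simp add: sum.reindex inj_on_def sum.distrib)
  finally show ?thesis .
qed

lemma abs_ybar_le_1:
  assumes "y \<in> cube m" "I \<in> coords m t"
  shows "\<bar>ybar y I\<bar> \<le> 1"
proof -
  have "\<bar>\<Prod>i\<in>S. y i\<bar> = 1" if "S \<subseteq> {1..m}" for S
  proof -
    have "\<bar>y i\<bar> = 1" if "i \<in> S" for i
    proof -
      have "i \<in> {1..m}" using \<open>S \<subseteq> {1..m}\<close> that by auto
      with assms(1) have "y i \<in> {-1, 1}" unfolding cube_def by (rule PiE_mem)
      then show ?thesis by auto
    qed
    then show ?thesis by (simp add: abs_prod)
  qed
  then show ?thesis
    using assms(2) by (auto simp: coords_def subsets_le_def)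
qed

lemma mpoly_degree_le_iff:
  "mpoly_degree m c \<le> t \<longleftrightarrow> (\<forall>S\<subseteq>{1..m}. c S \<noteq> 0 \<longrightarrow> card S \<le> t)"
  unfolding mpoly_degree_def by (subst Max_le_iff) auto

text \<open>Averaging coefficients over the rows preserves all three bounds: a nonzero average needs
  a nonzero coefficient in some row, the weight obeys the triangle inequality, and the error is an
  average of errors.\<close>

lemma approximates_db_fun:
  assumes approx: "approximates m (bounded_polys t W m) \<gamma> X Y q"
    and D: "D \<noteq> []" "set D \<subseteq> X"
  shows "\<exists>c\<in>bounded_polys t W m. \<forall>y\<in>Y. \<bar>mpoly_eval m c y - db_fun q D y\<bar> \<le> \<gamma>"
proof -
  obtain P where P: "\<And>x. x \<in> X \<Longrightarrow> P x \<in> bounded_polys t W m"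
    "\<And>x y. x \<in> X \<Longrightarrow> y \<in> Y \<Longrightarrow> \<bar>mpoly_eval m (P x) y - query_fun q x y\<bar> \<le> \<gamma>"
    using approx unfolding approximates_def by metis
  define n where "n = length D"
  have n: "n > 0" using D by (simp add: n_def)
  have DX: "D ! i \<in> X" if "i < n" for i using D that by (auto simp: n_def)
  define c where "c S = (\<Sum>i<n. P (D ! i) S) / n" for S
  have supp: "c S = 0" if "\<not> S \<subseteq> {1..m}" for S
    using P(1) DX that by (simp add: c_def bounded_polys_def)
  have deg: "mpoly_degree m c \<le> t"
    unfolding mpoly_degree_le_iff
  proof (intro allI impI)
    fix S assume S: "S \<subseteq> {1..m}" "c S \<noteq> 0"
    then have "(\<Sum>i<n. P (D ! i) S) \<noteq> 0" by (simp add: c_def)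
    then obtain i where "i < n" "P (D ! i) S \<noteq> 0" by (meson lessThan_iff sum.neutral)
    then show "card S \<le> t"
      using P(1)[OF DX] S(1) by (auto simp: bounded_polys_def mpoly_degree_le_iff)
  qed
  have "mpoly_weight m c \<le> (\<Sum>S\<in>Pow {1..m}. (\<Sum>i<n. \<bar>P (D ! i) S\<bar>) / n)"
    unfolding mpoly_weight_def c_def
    by (intro sum_mono) (simp add: divide_right_mono sum_abs)
  also have "\<dots> = (\<Sum>i<n. mpoly_weight m (P (D ! i))) / n"
    unfolding mpoly_weight_def sum_divide_distrib[symmetric] by (subst sum.swap) simp
  also have "\<dots> \<le> (\<Sum>i<n. W) / n"
    using P(1)[OF DX] by (intro divide_right_mono sum_mono) (auto simp: bounded_polys_def)
  also have "\<dots> = W" using n by simp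
  finally have weight: "mpoly_weight m c \<le> W" .
  have "\<bar>mpoly_eval m c y - db_fun q D y\<bar> \<le> \<gamma>" if y: "y \<in> Y" for y
  proof -
    have "mpoly_eval m c y = (\<Sum>S\<in>Pow {1..m}. (\<Sum>i<n. P (D ! i) S * (\<Prod>i\<in>S. y i))) / n"
      unfolding mpoly_eval_def c_def
      by (simp add: sum_divide_distrib sum_distrib_right)
    also have "\<dots> = (\<Sum>i<n. mpoly_eval m (P (D ! i)) y) / n"
      unfolding mpoly_eval_def by (subst sum.swap) simp
    finally have 1: "mpoly_eval m c y = (\<Sum>i<n. mpoly_eval m (P (D ! i)) y) / n" .
    have 2: "db_fun q D y = (\<Sum>i<n. query_fun q (D ! i) y) / n"
      unfolding db_fun_def n_def by (simp add: sum_list_sum_nth atLeast0LessThan)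
    have "\<bar>mpoly_eval m c y - db_fun q D y\<bar>
        = \<bar>\<Sum>i<n. mpoly_eval m (P (D ! i)) y - query_fun q (D ! i) y\<bar> / n"
      unfolding 1 2 by (simp add: sum_subtractf diff_divide_distrib[symmetric])
    also have "\<dots> \<le> (\<Sum>i<n. \<bar>mpoly_eval m (P (D ! i)) y - query_fun q (D ! i) y\<bar>) / n"
      by (intro divide_right_mono sum_abs) simp
    also have "\<dots> \<le> (\<Sum>i<n. \<gamma>) / n"
      using P(2)[OF DX y] by (intro divide_right_mono sum_mono) auto
    also have "\<dots> = \<gamma>" using n by simp
    finally show ?thesis .
  qed
  with supp deg weight show ?thesis
    by (intro bexI[of _ c]) (auto simp: bounded_polys_def)
qed

lemma bounded_poly_as_distribution:
  assumes W: "W > 0" and c: "c \<in> bounded_polys t W m"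
  shows "\<exists>u. (\<forall>I\<in>coords m t. u I \<ge> 0) \<and> sum u (coords m t) = 1 \<and>
    (\<forall>y. W * dot m t u (ybar y) = mpoly_eval m c y)"
proof -
  \<comment> \<open>The slack on \<open>Zero\<close> is nonnegative because the weight is at most
    \<open>W\<close>. It raises the total mass to 1 without changing the represented function, as
    \<open>ybar y Zero = 0\<close>.\<close>
  define u where "u I = (case I of Zero \<Rightarrow> 1 - mpoly_weight m c / W
    | Pos S \<Rightarrow> max 0 (c S) / W | Neg S \<Rightarrow> max 0 (- c S) / W)" for I
  have le: "mpoly_weight m c \<le> W" using c by (simp add: bounded_polys_def)
  \<comment> \<open>By the degree bound, sums over all monomials reduce to sums over the available
    coordinates.\<close>
  have vanish: "c S = 0" if "S \<in> Pow {1..m} - subsets_le m t" for S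
    using c that by (auto simp: bounded_polys_def mpoly_degree_le_iff subsets_le_def)
  have to_subsets_le: "(\<Sum>S\<in>Pow {1..m}. f S) = (\<Sum>S\<in>subsets_le m t. f S)"
    if "\<And>S. c S = 0 \<Longrightarrow> f S = (0::real)" for f
    using that vanish by (intro sum.mono_neutral_right) (auto simp: subsets_le_def)
  have "(\<Sum>S\<in>subsets_le m t. u (Pos S) + u (Neg S)) = (\<Sum>S\<in>subsets_le m t. \<bar>c S\<bar> / W)"
    by (intro sum.cong) (auto simp: u_def add_divide_distrib[symmetric] max_def)
  also have "\<dots> = mpoly_weight m c / W"
    unfolding mpoly_weight_def sum_divide_distrib[symmetric] by (subst to_subsets_le) auto
  finally have "sum u (coords m t) = 1"
    by (simp add: sum_coords u_def)
  moreover have "\<forall>I\<in>coords m t. u I \<ge> 0"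
    using W le by (auto simp: u_def split: coord.split)
  moreover have "W * dot m t u (ybar y) = mpoly_eval m c y" for y
  proof -
    have "W * dot m t u (ybar y)
      = (\<Sum>S\<in>subsets_le m t. W * (u (Pos S) * (\<Prod>i\<in>S. y i) - u (Neg S) * (\<Prod>i\<in>S. y i)))"
      unfolding dot_def sum_coords by (simp add: sum_distrib_left)
    also have "\<dots> = (\<Sum>S\<in>subsets_le m t. c S * (\<Prod>i\<in>S. y i))"
      using W by (intro sum.cong) (auto simp: u_def max_def field_simps)
    also have "\<dots> = mpoly_eval m c y"
      unfolding mpoly_eval_def by (subst to_subsets_le) auto
    finally show ?thesis .
  qed
  ultimately show ?thesis by blast
qed

section \<open>The cross entropy potential along a play\<close>

definition pos_dist :: "nat \<Rightarrow> nat \<Rightarrow> (coord \<Rightarrow> real) \<Rightarrow> bool" where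
  "pos_dist m t p \<longleftrightarrow> (\<forall>I\<in>coords m t. p I > 0) \<and> sum p (coords m t) = 1"

text \<open>This is the relative entropy of \<open>u\<close> with respect to \<open>p\<close> plus
  the entropy of \<open>u\<close>. The latter does not depend on \<open>p\<close>, so both decrease
  equally; this form takes no logarithm of entries of \<open>u\<close>, which may be 0.\<close>

definition cross_entropy :: "nat \<Rightarrow> nat \<Rightarrow> (coord \<Rightarrow> real) \<Rightarrow> (coord \<Rightarrow> real) \<Rightarrow> real" where
  "cross_entropy m t u p = (\<Sum>I\<in>coords m t. u I * - ln (p I))"

lemma dimN_pos: "dimN m t > 0"
  by (simp add: dimN_def)

lemma pos_dist_mw_init: "pos_dist m t (mw_init m t)"
  using dimN_pos[of m t] by (simp add: pos_dist_def mw_init_def card_coords)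

lemma cross_entropy_mw_init:
  assumes "sum u (coords m t) = 1"
  shows "cross_entropy m t u (mw_init m t) = ln (real (dimN m t))"
proof -
  have "cross_entropy m t u (mw_init m t) = (\<Sum>I\<in>coords m t. u I * ln (real (dimN m t)))"
    unfolding cross_entropy_def mw_init_def
    using dimN_pos[of m t] by (intro sum.cong) (auto simp: ln_div)
  then show ?thesis using assms by (simp add: sum_distrib_right[symmetric])
qed

lemma cross_entropy_nonneg:
  assumes "pos_dist m t p" "\<And>I. I \<in> coords m t \<Longrightarrow> u I \<ge> 0"
  shows "cross_entropy m t u p \<ge> 0"
  unfolding cross_entropy_def
proof (intro sum_nonneg mult_nonneg_nonneg)
  fix I assume I: "I \<in> coords m t"
  have "p I \<le> sum p (coords m t)"
    using assms(1) I by (intro member_le_sum finite_coords) (auto simp: pos_dist_def less_imp_le)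
  then show "0 \<le> - ln (p I)" using assms(1) I by (simp add: pos_dist_def)
qed (use assms in auto)

lemma mw_update_mistake:
  assumes \<alpha>: "\<alpha> > 0" and W: "W > 0" and y: "y \<in> cube m"
    and p: "pos_dist m t p"
    and u: "\<And>I. I \<in> coords m t \<Longrightarrow> u I \<ge> 0" "sum u (coords m t) = 1"
    and close: "\<bar>W * dot m t u (ybar y) - v\<bar> \<le> \<alpha> / 4"
    and mistake: "\<bar>hyp_eval m t W p y - v\<bar> > \<alpha>"
    and a: "\<bar>a - v\<bar> \<le> \<alpha> / 2"
  shows "pos_dist m t (mw_update m t W \<alpha> p y a)"
    and "cross_entropy m t u (mw_update m t W \<alpha> p y a)
      \<le> cross_entropy m t u p - 2 * (\<alpha> / (4 * W))\<^sup>2"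
proof -
  define \<eta> where "\<eta> = \<alpha> / (4 * W)"
  define r where "r = (if a < hyp_eval m t W p y then ybar y else (\<lambda>I. - ybar y I))"
  define Z where "Z = (\<Sum>I\<in>coords m t. exp (- \<eta> * r I) * p I)"
  note [simp] = finite_coords
  have \<eta>0: "\<eta> > 0" using \<alpha> W by (simp add: \<eta>_def)
  have p0: "\<And>I. I \<in> coords m t \<Longrightarrow> p I > 0" "sum p (coords m t) = 1"
    using p by (auto simp: pos_dist_def)
  have r1: "\<bar>r I\<bar> \<le> 1" if "I \<in> coords m t" for I
    using abs_ybar_le_1[OF y that] by (simp add: r_def)
  have "(\<Sum>I\<in>coords m t. \<bar>exp (- \<eta> * r I) * p I\<bar>) = Z"
    unfolding Z_def using p0(1) by (intro sum.cong) (auto simp: abs_mult less_imp_le)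
  then have upd: "mw_update m t W \<alpha> p y a = (\<lambda>I\<in>coords m t. exp (- \<eta> * r I) * p I / Z)"
    by (simp add: mw_update_def Let_def r_def \<eta>_def l1_norm_def)
  have ne: "coords m t \<noteq> {}" by (auto simp: coords_def)
  have Zpos: "Z > 0" unfolding Z_def using p0(1) ne by (intro sum_pos) auto
  show "pos_dist m t (mw_update m t W \<alpha> p y a)"
    using Zpos p0(1) by (simp add: pos_dist_def upd sum_divide_distrib[symmetric] Z_def)
  define gap where "gap = (\<Sum>I\<in>coords m t. p I * r I) - (\<Sum>I\<in>coords m t. u I * r I)"
  \<comment> \<open>The answer is off by at most \<alpha>/2 while the hypothesis is off by more than
    \<alpha>, so comparing with \<open>a\<close> shows on which side of \<open>v\<close> the
    hypothesis lies. The distribution \<open>u\<close> is within \<alpha>/4 of \<open>v\<close>,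
    which leaves a gap above 3\<alpha>/4.\<close>
  have gap: "3 * \<alpha> / 4 < W * gap"
  proof (cases "a < hyp_eval m t W p y")
    case True
    then have "W * gap = hyp_eval m t W p y - W * dot m t u (ybar y)"
      by (simp add: gap_def r_def hyp_eval_def dot_def right_diff_distrib)
    then show ?thesis using True mistake a close \<alpha> by linarith
  next
    case False
    then have "W * gap = W * dot m t u (ybar y) - hyp_eval m t W p y"
      by (simp add: gap_def r_def hyp_eval_def dot_def right_diff_distrib sum_negf)
    then show ?thesis using False mistake a close \<alpha> by linarith
  qed
  then have gap3: "3 * \<eta> < gap"
    using W by (simp add: \<eta>_def field_simps)
  \<comment> \<open>The gap is at most 2, so the mistake itself forces
    \<open>3 * \<eta> < 2\<close>; this supplies the \<open>\<eta> \<le> 1\<close> required by the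
    reweighting estimate.\<close>
  have "gap = (\<Sum>I\<in>coords m t. (p I - u I) * r I)"
    by (simp add: gap_def sum_subtractf left_diff_distrib)
  also have "\<dots> \<le> (\<Sum>I\<in>coords m t. p I + u I)"
  proof (rule sum_mono)
    fix I assume I: "I \<in> coords m t"
    have "(p I - u I) * r I \<le> \<bar>p I - u I\<bar> * \<bar>r I\<bar>" by (simp add: abs_mult[symmetric])
    also have "\<dots> \<le> \<bar>p I - u I\<bar> * 1" using r1[OF I] by (intro mult_left_mono) auto
    also have "\<dots> \<le> p I + u I" using p0(1)[OF I] u(1)[OF I] by simp
    finally show "(p I - u I) * r I \<le> p I + u I" .
  qed
  also have "\<dots> = 2" using p0(2) u(2) by (simp add: sum.distrib)
  finally have \<eta>1: "\<eta> \<le> 1" using gap3 by simp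
  have "cross_entropy m t u (mw_update m t W \<alpha> p y a)
      = (\<Sum>I\<in>coords m t. u I * - ln (exp (- \<eta> * r I) * p I / Z))"
    unfolding cross_entropy_def upd by (intro sum.cong) auto
  also have "\<dots> \<le> cross_entropy m t u p - \<eta> * gap + \<eta>\<^sup>2"
    using cross_entropy_reweight_le[OF finite_coords p0 u r1 _ \<eta>1 Z_def] \<eta>0
    by (simp add: cross_entropy_def gap_def)
  also have "\<dots> \<le> cross_entropy m t u p - 2 * \<eta>\<^sup>2"
    using mult_strict_left_mono[OF gap3 \<eta>0] by (simp add: power2_eq_square)
  finally show "cross_entropy m t u (mw_update m t W \<alpha> p y a)
      \<le> cross_entropy m t u p - 2 * (\<alpha> / (4 * W))\<^sup>2"
    by (simp add: \<eta>_def)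
qed

text \<open>A play is infinite, but the potential only controls mistakes up to a given round. Every
  finite set of naturals lies in some prefix, and a set whose finite subsets have bounded
  cardinality is finite.\<close>

lemma finite_card_le_if_prefixes:
  fixes M :: "nat set"
  assumes "\<And>n. card {s \<in> M. s < n} \<le> b"
  shows "finite M \<and> card M \<le> b"
proof -
  have "card A \<le> b" if A: "finite A" "A \<subseteq> M" for A
  proof -
    obtain n where "A \<subseteq> {..<n}"
      using A(1) unfolding finite_nat_set_iff_bounded by auto
    then have "card A \<le> card {s \<in> M. s < n}" using A by (intro card_mono) auto
    then show ?thesis using assms le_trans by blast
  qed
  then show ?thesis
    using finite_if_finite_subsets_card_bdd[of M b] by blast
qed

lemma mw_is_IDC:
  assumes \<alpha>: "\<alpha> > 0" and W: "W > 0" and Y: "Y \<subseteq> cube m"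
    and approx: "approximates m (bounded_polys t W m) (\<alpha> / 4) X Y q"
  shows "is_IDC (hyp_eval m t W) (mw_init m t) (mw_update m t W \<alpha>) X Y q \<alpha>
    (16 * W\<^sup>2 * ln (2 * real (binom_le m t) + 1) / \<alpha>\<^sup>2)"
  unfolding is_IDC_def
proof (intro allI impI)
  fix D y a h
  assume D: "D \<noteq> []" "set D \<subseteq> X"
    and play: "idc_play (hyp_eval m t W) (mw_init m t) (mw_update m t W \<alpha>) Y (db_fun q D) \<alpha> y a h"
  define f where "f = db_fun q D"
  define M where "M = {s. 1 \<le> s \<and> mistake (hyp_eval m t W) f \<alpha> (h s) (y s)}"
  define \<eta> where "\<eta> = \<alpha> / (4 * W)"
  define B where "B = 16 * W\<^sup>2 * ln (2 * real (binom_le m t) + 1) / \<alpha>\<^sup>2"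
  obtain c where c: "c \<in> bounded_polys t W m"
    "\<And>y. y \<in> Y \<Longrightarrow> \<bar>mpoly_eval m c y - f y\<bar> \<le> \<alpha> / 4"
    using approximates_db_fun[OF approx D] by (auto simp: f_def)
  obtain u where u: "\<And>I. I \<in> coords m t \<Longrightarrow> u I \<ge> 0" "sum u (coords m t) = 1"
    "\<And>y. W * dot m t u (ybar y) = mpoly_eval m c y"
    using bounded_poly_as_distribution[OF W c(1)] by auto
  \<comment> \<open>Rounds start at 1: \<open>h (Suc n)\<close> is the hypothesis after
    \<open>n\<close> rounds, and the mistakes counted are those of rounds 1 to
    \<open>n\<close>.\<close>
  have inv: "pos_dist m t (h (Suc n)) \<and>
    cross_entropy m t u (h (Suc n)) + 2 * \<eta>\<^sup>2 * card {s \<in> M. s < Suc n} \<le> ln (dimN m t)" for n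
  proof (induction n)
    case 0
    have none: "{s \<in> M. s < Suc 0} = {}" by (auto simp: M_def)
    show ?case
      using play pos_dist_mw_init cross_entropy_mw_init[OF u(2)]
      unfolding none by (simp add: idc_play_def)
  next
    case (Suc n)
    have rnd: "y (Suc n) \<in> Y"
      "if mistake (hyp_eval m t W) f \<alpha> (h (Suc n)) (y (Suc n))
       then \<bar>a (Suc n) - f (y (Suc n))\<bar> \<le> \<alpha> / 2 \<and>
         h (Suc (Suc n)) = mw_update m t W \<alpha> (h (Suc n)) (y (Suc n)) (a (Suc n))
       else h (Suc (Suc n)) = h (Suc n)"
      using play unfolding idc_play_def f_def[symmetric] by (metis le_add1 plus_1_eq_Suc)+
    show ?case
    proof (cases "Suc n \<in> M")
      case True
      then have mis: "mistake (hyp_eval m t W) f \<alpha> (h (Suc n)) (y (Suc n))"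
        by (simp add: M_def)
      then have h': "\<bar>a (Suc n) - f (y (Suc n))\<bar> \<le> \<alpha> / 2"
        "h (Suc (Suc n)) = mw_update m t W \<alpha> (h (Suc n)) (y (Suc n)) (a (Suc n))"
        using rnd(2) by auto
      have "{s \<in> M. s < Suc (Suc n)} = insert (Suc n) {s \<in> M. s < Suc n}"
        using True by auto
      then have card: "card {s \<in> M. s < Suc (Suc n)} = Suc (card {s \<in> M. s < Suc n})"
        by simp
      have "\<bar>W * dot m t u (ybar (y (Suc n))) - f (y (Suc n))\<bar> \<le> \<alpha> / 4"
        using c(2)[OF rnd(1)] u(3) by simp
      note step = mw_update_mistake[OF \<alpha> W _ conjunct1[OF Suc.IH] u(1,2) this _ h'(1)]
      show ?thesis
        using step Y rnd(1) mis Suc.IH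
        unfolding card h'(2) by (auto simp: mistake_def \<eta>_def algebra_simps)
    next
      case False
      then have "{s \<in> M. s < Suc (Suc n)} = {s \<in> M. s < Suc n}"
        by (auto simp: less_Suc_eq)
      moreover have "h (Suc (Suc n)) = h (Suc n)"
        using rnd(2) False by (simp add: M_def)
      ultimately show ?thesis using Suc.IH by simp
    qed
  qed
  have \<eta>0: "\<eta> > 0" using \<alpha> W by (simp add: \<eta>_def)
  have ln0: "ln (real (dimN m t)) \<ge> 0" by (simp add: dimN_def)
  have B: "B = ln (dimN m t) / \<eta>\<^sup>2"
    using \<alpha> W by (simp add: B_def \<eta>_def dimN_def power_divide power_mult_distrib add.commute)
  have le_B: "real (card {s \<in> M. s < n}) \<le> B" for n
  proof -
    have "{s \<in> M. s < n} \<subseteq> {s \<in> M. s < Suc n}" by auto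
    then have le: "card {s \<in> M. s < n} \<le> card {s \<in> M. s < Suc n}" by (intro card_mono) auto
    have "0 \<le> cross_entropy m t u (h (Suc n))"
      using cross_entropy_nonneg[OF conjunct1[OF inv]] u(1) by blast
    \<comment> \<open>The invariant pays \<open>2 * \<eta>\<^sup>2\<close> per mistake, whereas
      \<open>B\<close> equals \<open>ln N / \<eta>\<^sup>2\<close>; one of the two copies is
      dropped.\<close>
    moreover have "0 \<le> \<eta>\<^sup>2 * card {s \<in> M. s < Suc n}" by simp
    ultimately have "\<eta>\<^sup>2 * card {s \<in> M. s < Suc n} \<le> ln (dimN m t)"
      using conjunct2[OF inv[of n]] by linarith
    then have "real (card {s \<in> M. s < Suc n}) \<le> B"
      using \<eta>0 by (simp add: B field_simps)
    with le show ?thesis by linarith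
  qed
  have B0: "B \<ge> 0" using ln0 \<eta>0 by (simp add: B)
  \<comment> \<open>The prefix lemma takes a natural bound, hence the rounding down;
    \<open>B0\<close> allows the return to the real bound.\<close>
  have "finite M \<and> card M \<le> nat \<lfloor>B\<rfloor>"
    using le_B by (intro finite_card_le_if_prefixes) (simp add: le_nat_floor)
  then have "finite M" "real (card M) \<le> B"
    using B0 by (auto simp: le_nat_iff le_floor_iff)
  then show "finite {s. 1 \<le> s \<and> mistake (hyp_eval m t W) (db_fun q D) \<alpha> (h s) (y s)} \<and>
      real (card {s. 1 \<le> s \<and> mistake (hyp_eval m t W) (db_fun q D) \<alpha> (h s) (y s)})
      \<le> 16 * W\<^sup>2 * ln (2 * real (binom_le m t) + 1) / \<alpha>\<^sup>2"
    by (simp add: M_def f_def B_def)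
qed

subsection \<open>The order of the coordinates\<close>

lemma set_decode_less:
  assumes "n < 2 ^ k"
  shows "set_decode n \<subseteq> {..<k}"
proof
  fix i assume "i \<in> set_decode n"
  then have "\<not> n < 2 ^ i" by (auto simp: set_decode_def)
  then have "(2::nat) ^ i < 2 ^ k" using assms by linarith
  then show "i \<in> {..<k}" by simp
qed

lemma set_decode_add_power:
  assumes "n < 2 ^ k"
  shows "set_decode (2 ^ k + n) = insert k (set_decode n)"
  using set_decode_less[OF assms] set_decode_plus_power_2[of k n] by (auto simp: add.commute)

text \<open>The assumption admits sets containing 0 because codes below \<open>2 ^ Suc m\<close>
  also use bit 0; for such sets both sides of each equivalence are false.\<close>

lemma subsets_le_Suc:
  assumes "S \<subseteq> {..m}"
  shows "S \<in> subsets_le (Suc m) t \<longleftrightarrow> S \<in> subsets_le m t"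
    and "insert (Suc m) S \<in> subsets_le (Suc m) t \<longleftrightarrow> S \<in> subsets_le m t \<and> card S < t"
proof -
  have fin: "finite S" using assms finite_subset by blast
  have nin: "Suc m \<notin> S" using assms by auto
  show "S \<in> subsets_le (Suc m) t \<longleftrightarrow> S \<in> subsets_le m t"
    using assms by (fastforce simp: subsets_le_def)
  show "insert (Suc m) S \<in> subsets_le (Suc m) t \<longleftrightarrow> S \<in> subsets_le m t \<and> card S < t"
    using assms fin nin by (fastforce simp: subsets_le_def)
qed

lemma subset_list_0: "subset_list 0 t = [{}]"
proof -
  have "set_decode (Suc 0) \<noteq> {}" by (metis One_nat_def empty_iff odd_one set_decode_0)
  then show ?thesis by (simp add: subset_list_def subsets_le_def upt_rec)
qed

text \<open>The codes below \<open>2 ^ Suc (Suc m)\<close> fall into two halves. The lower half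
  lists the sets for \<open>m\<close>; the upper half repeats it with bit \<open>Suc m\<close>
  added, in the same order, and the size filter then demands one element less.\<close>

lemma subset_list_Suc:
  "subset_list (Suc m) t = subset_list m t @
    map (insert (Suc m)) (filter (\<lambda>S. card S < t) (subset_list m t))"
proof -
  let ?k = "2 ^ Suc m :: nat"
  have dec: "set_decode n \<subseteq> {..m}" if "n < ?k" for n
    using set_decode_less[OF that] by auto
  have "[0..<2 ^ Suc (Suc m)] = [0..<?k] @ map (\<lambda>n. ?k + n) [0..<?k]"
  proof -
    have "[0..<2 ^ Suc (Suc m)] = [0..<?k + ?k]" by (simp add: mult_2)
    also have "\<dots> = [0..<?k] @ [?k..<?k + ?k]" by (rule upt_add_eq_append) simp
    also have "[?k..<?k + ?k] = map (\<lambda>n. n + ?k) [0..<?k]" by (subst map_add_upt) simp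
    finally show ?thesis by (simp add: add.commute)
  qed
  moreover have "filter (\<lambda>S. S \<in> subsets_le (Suc m) t) (map set_decode [0..<?k]) = subset_list m t"
    unfolding subset_list_def using dec by (intro filter_cong) (auto simp: subsets_le_Suc(1))
  moreover have "filter (\<lambda>S. S \<in> subsets_le (Suc m) t) (map set_decode (map (\<lambda>n. ?k + n) [0..<?k]))
      = map (insert (Suc m)) (filter (\<lambda>S. card S < t) (subset_list m t))"
  proof -
    have 1: "map set_decode (map (\<lambda>n. ?k + n) [0..<?k]) = map (insert (Suc m)) (map set_decode [0..<?k])"
      unfolding map_map by (intro map_cong) (auto simp: set_decode_add_power simp del: power_Suc)
    have 2: "filter (\<lambda>S. insert (Suc m) S \<in> subsets_le (Suc m) t) (map set_decode [0..<?k])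
        = filter (\<lambda>S. S \<in> subsets_le m t \<and> card S < t) (map set_decode [0..<?k])"
      using dec by (intro filter_cong) (auto simp: subsets_le_Suc(2) simp del: power_Suc)
    show ?thesis
      unfolding 1 subset_list_def filter_map[of _ "insert (Suc m)"] o_def 2 filter_filter ..
  qed
  ultimately show ?thesis
    by (simp add: subset_list_def[of "Suc m"] del: power_Suc)
qed

lemma length_coord_list: "length (coord_list m t) = dimN m t"
  by (metis card_coords distinct_card distinct_coord_list set_coord_list)

lemma length_subset_list: "length (subset_list m t) = binom_le m t"
  using length_coord_list[of m t] by (simp add: coord_list_def dimN_def)

lemma binom_le_mono: "m \<le> n \<Longrightarrow> binom_le m t \<le> binom_le n t"
  unfolding binom_le_def
  by (intro card_mono finite_subsets_le) (auto simp: subsets_le_def)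

lemma binom_le_pos: "binom_le m t > 0"
proof -
  have "{} \<in> subsets_le m t" by (simp add: subsets_le_def)
  then show ?thesis
    unfolding binom_le_def using finite_subsets_le card_gt_0_iff by blast
qed

text \<open>Counting singletons suffices. This bounds the number of iterations over the variables by
  the size parameter of the running time.\<close>

lemma le_binom_le:
  assumes "t > 0"
  shows "m \<le> binom_le m t"
proof -
  have "card ((\<lambda>i. {i}) ` {1..m}) \<le> binom_le m t"
    unfolding binom_le_def using assms
    by (intro card_mono finite_subsets_le) (auto simp: subsets_le_def)
  then show ?thesis by (simp add: card_image)
qed

lemma coord_list_nth:
  shows "coord_list m t ! 0 = Zero"
    and "j < binom_le m t \<Longrightarrow> coord_list m t ! Suc j = Pos (subset_list m t ! j)"
    and "j < binom_le m t \<Longrightarrow> coord_list m t ! Suc (binom_le m t + j) = Neg (subset_list m t ! j)"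
  by (simp_all add: coord_list_def nth_append length_subset_list)

lemma sum_coords_nth: "(\<Sum>I\<in>coords m t. f I) = (\<Sum>j<dimN m t. f (coord_list m t ! j))"
  using sum.reindex_bij_betw[OF bij_betw_nth[OF distinct_coord_list[of m t] refl set_coord_list[symmetric]],
      of f]
  by (simp add: length_coord_list)

subsection \<open>Total correctness with time bounds\<close>

text \<open>Time is counted in units of \<open>Suc \<kappa>\<close>, which dominates the cost of every instruction and test.\<close>

definition triple :: "nat \<Rightarrow> (store \<Rightarrow> bool) \<Rightarrow> com \<Rightarrow> nat \<Rightarrow> (store \<Rightarrow> bool) \<Rightarrow> bool" where
  "triple \<kappa> P c b Q \<longleftrightarrow>
    (\<forall>s. P s \<longrightarrow> (\<exists>n s'. exec \<kappa> c s n s' \<and> n \<le> Suc \<kappa> * b \<and> Q s'))"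

lemma instr_cost_le: "instr_cost \<kappa> i \<le> Suc \<kappa>"
  by (cases i) auto

lemma test_cost_le: "test_cost \<kappa> b \<le> Suc \<kappa>"
  by (cases b) auto

lemma triple_Seq:
  assumes "triple \<kappa> P c b1 Q" "triple \<kappa> Q d b2 R"
  shows "triple \<kappa> P (Seq c d) (b1 + b2) R"
  unfolding triple_def
proof (intro allI impI)
  fix s assume "P s"
  then obtain n1 s1 where 1: "exec \<kappa> c s n1 s1" "n1 \<le> Suc \<kappa> * b1" "Q s1"
    using assms(1) unfolding triple_def by blast
  then obtain n2 s2 where 2: "exec \<kappa> d s1 n2 s2" "n2 \<le> Suc \<kappa> * b2" "R s2"
    using assms(2) unfolding triple_def by blast
  show "\<exists>n s'. exec \<kappa> (Seq c d) s n s' \<and> n \<le> Suc \<kappa> * (b1 + b2) \<and> R s'"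
  proof (intro exI conjI)
    show "exec \<kappa> (Seq c d) s (n1 + n2) s2" using 1 2 exec.Seq by blast
    show "n1 + n2 \<le> Suc \<kappa> * (b1 + b2)" using 1 2 by (simp add: distrib_left)
  qed (fact 2)
qed

lemma triple_weaken:
  assumes "triple \<kappa> P c b Q" "\<And>s. P' s \<Longrightarrow> P s" "\<And>s. Q s \<Longrightarrow> Q' s" "b \<le> b'"
  shows "triple \<kappa> P' c b' Q'"
proof -
  have "Suc \<kappa> * b \<le> Suc \<kappa> * b'" using assms(4) by (rule mult_le_mono2)
  then show ?thesis using assms(1-3) unfolding triple_def by (meson le_trans)
qed

lemma triple_Cond:
  assumes "triple \<kappa> (\<lambda>s. P s \<and> run_test e s) c b Q" "triple \<kappa> (\<lambda>s. P s \<and> \<not> run_test e s) d b Q"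
  shows "triple \<kappa> P (Cond e c d) (Suc b) Q"
  unfolding triple_def
proof (intro allI impI)
  fix s assume P: "P s"
  have bound: "test_cost \<kappa> e + n \<le> Suc \<kappa> * Suc b" if "n \<le> Suc \<kappa> * b" for n
    using that test_cost_le[of \<kappa> e] by simp
  show "\<exists>n s'. exec \<kappa> (Cond e c d) s n s' \<and> n \<le> Suc \<kappa> * Suc b \<and> Q s'"
  proof (cases "run_test e s")
    case True
    then obtain n s' where "exec \<kappa> c s n s'" "n \<le> Suc \<kappa> * b" "Q s'"
      using assms(1) P unfolding triple_def by blast
    then show ?thesis using exec.CondTrue[OF True] bound by blast
  next
    case False
    then obtain n s' where "exec \<kappa> d s n s'" "n \<le> Suc \<kappa> * b" "Q s'"
      using assms(2) P unfolding triple_def by blast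
    then show ?thesis using exec.CondFalse[OF False] bound by blast
  qed
qed

text \<open>The invariant is indexed by the number of completed iterations, and the proof is by
  induction on the remaining ones. Each iteration pays for the body and one test; the last unit pays
  for the failing test.\<close>

lemma triple_For:
  assumes body: "\<And>i. i < k \<Longrightarrow> triple \<kappa> (I i) c b (I (Suc i))"
    and test: "\<And>i s. i \<le> k \<Longrightarrow> I i s \<Longrightarrow> run_test e s \<longleftrightarrow> i < k"
  shows "triple \<kappa> (I 0) (While e c) (k * Suc b + 1) (I k)"
proof -
  have "triple \<kappa> (I (k - j)) (While e c) (j * Suc b + 1) (I k)" if "j \<le> k" for j
    using that
  proof (induction j)
    case 0
    show ?case unfolding triple_def
    proof (intro allI impI)
      fix s assume "I (k - 0) s"
      moreover from this have "\<not> run_test e s" using test[of k s] by simp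
      ultimately show "\<exists>n s'. exec \<kappa> (While e c) s n s' \<and> n \<le> Suc \<kappa> * (0 * Suc b + 1) \<and> I k s'"
        using exec.WhileFalse[of e s \<kappa> c] test_cost_le[of \<kappa> e]
        by (intro exI[of _ "test_cost \<kappa> e"] exI[of _ s]) simp
    qed
  next
    case (Suc j)
    have lt: "k - Suc j < k" "Suc (k - Suc j) = k - j" using Suc.prems by auto
    show ?case unfolding triple_def
    proof (intro allI impI)
      fix s assume I: "I (k - Suc j) s"
      then have t: "run_test e s" using test[of "k - Suc j" s] lt by simp
      obtain n1 s1 where 1: "exec \<kappa> c s n1 s1" "n1 \<le> Suc \<kappa> * b" "I (k - j) s1"
        using body[OF lt(1)] I unfolding triple_def lt(2) by blast
      then obtain n2 s2 where 2: "exec \<kappa> (While e c) s1 n2 s2" "n2 \<le> Suc \<kappa> * (j * Suc b + 1)" "I k s2"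
        using Suc unfolding triple_def by (meson Suc_leD)
      show "\<exists>n s'. exec \<kappa> (While e c) s n s' \<and> n \<le> Suc \<kappa> * (Suc j * Suc b + 1) \<and> I k s'"
      proof (intro exI conjI)
        show "exec \<kappa> (While e c) s (test_cost \<kappa> e + n1 + n2) s2"
          using exec.WhileTrue[OF t 1(1) 2(1)] .
        have "Suc j * Suc b + 1 = 1 + b + (j * Suc b + 1)" by simp
        then have "Suc \<kappa> * (Suc j * Suc b + 1) = Suc \<kappa> + Suc \<kappa> * b + Suc \<kappa> * (j * Suc b + 1)"
          by (simp only: distrib_left mult_1_right)
        then show "test_cost \<kappa> e + n1 + n2 \<le> Suc \<kappa> * (Suc j * Suc b + 1)"
          using 1(2) 2(2) test_cost_le[of \<kappa> e] by linarith
      qed (fact 2)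
    qed
  qed
  from this[of k] show ?thesis by simp
qed

text \<open>The first instruction is a separate argument because the language has no empty
  command.\<close>

fun block :: "instr \<Rightarrow> instr list \<Rightarrow> com" where
  "block i [] = Do i"
| "block i (j # js) = Seq (Do i) (block j js)"

lemma triple_Do:
  assumes "\<And>s. P s \<Longrightarrow> Q (run_instr i s)"
  shows "triple \<kappa> P (Do i) 1 Q"
  unfolding triple_def
proof (intro allI impI exI conjI)
  fix s assume "P s"
  then show "Q (run_instr i s)" by (rule assms)
  show "exec \<kappa> (Do i) s (instr_cost \<kappa> i) (run_instr i s)" by (rule exec.Do)
  show "instr_cost \<kappa> i \<le> Suc \<kappa> * 1" using instr_cost_le by simp
qed

text \<open>The intermediate assertions are weakest preconditions, so a straight-line program is
  verified by simplifying one composed store update.\<close>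

lemma triple_block:
  assumes "\<And>s. P s \<Longrightarrow> Q (fold run_instr (i # is) s)" and "b = Suc (length is)"
  shows "triple \<kappa> P (block i is) b Q"
  unfolding assms(2) using assms(1)
proof (induction "is" arbitrary: i P)
  case Nil
  then show ?case using triple_Do[of P Q i] by simp
next
  case (Cons j js)
  have "triple \<kappa> P (Do i) 1 (\<lambda>s. Q (fold run_instr (j # js) s))"
    using Cons.prems by (intro triple_Do) simp
  moreover have "triple \<kappa> (\<lambda>s. Q (fold run_instr (j # js) s)) (block j js) (Suc (length js)) Q"
    by (intro Cons.IH)
  ultimately show ?case using triple_Seq by fastforce
qed

subsection \<open>The program\<close>

text \<open>A write to counter variable 9, which nothing else in the program touches, stands for the
  empty command.\<close>

definition skip :: com where
  "skip = Do (NConst 9 0)"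

text \<open>Counter variables: \<open>2\<close> and \<open>4\<close> are loop indices, \<open>3\<close> is the number of sets listed so far,
  \<open>5\<close> is a loop bound, and \<open>6\<close>, \<open>7\<close> hold the constants \<open>1\<close>, \<open>0\<close>. Array \<open>0\<close> of naturals holds the
  cardinalities of the listed sets, array \<open>2\<close> of reals their monomials at \<open>y\<close>, and array \<open>3\<close> of
  reals the vector \<open>ybar y\<close>. Real variable \<open>5\<close> accumulates sums and \<open>6\<close> holds \<open>-\<eta>\<close> or \<open>\<eta>\<close>,
  according to the sign of the update.\<close>

definition extend_body :: com where
  "extend_body = Seq (Do (NLoad 8 0 4))
    (Seq (Cond (NLess 8 1)
        (block (NAdd 8 8 6) [NStore 0 3 8, RLoad 4 2 4, RMul 4 4 3, RStore 2 3 4, NAdd 3 3 6])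
        skip)
      (Do (NAdd 4 4 6)))"

text \<open>Adding the 0 in variable 7 copies the list length into variable 5. This freezes the loop
  bound: only sets listed before this variable was considered are extended, while variable 3 keeps
  growing.\<close>

definition enum_body :: com where
  "enum_body = Seq (block (NAdd 2 2 6) [RLoad 3 0 2, NAdd 5 3 7, NConst 4 0])
    (While (NLess 4 5) extend_body)"

text \<open>For \<open>t = 0\<close> the loop over the \<open>m\<close> variables must be skipped: the time may then not depend
  on \<open>m\<close>, as \<open>binom_le m 0 = 1\<close>.\<close>

definition enum_prog :: com where
  "enum_prog = Seq (block (NConst 6 1) [NConst 3 1, RConst 3 1, RStore 2 7 3])
    (Cond (NLess 7 1) (While (NLess 2 0) enum_body) skip)"

text \<open>The counter is incremented before storing, so slot 0 is left for \<open>Zero\<close>;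
  the negated monomial goes \<open>binom_le m t\<close> places further.\<close>

definition ybar_prog :: com where
  "ybar_prog = Seq (Do (NConst 4 0))
    (While (NLess 4 3) (block (RLoad 4 2 4)
      [NAdd 4 4 6, RStore 3 4 4, RConst 3 0, RSub 4 3 4, NAdd 8 4 3, RStore 3 8 4]))"

text \<open>Twice the number of sets plus 1 is \<open>dimN m t\<close>; counter variable 5 keeps
  this value for all later loops.\<close>

definition dot_prog :: com where
  "dot_prog = Seq (block (NAdd 5 3 3) [NAdd 5 5 6, NConst 4 0, RConst 5 0])
    (While (NLess 4 5) (block (RLoad 3 1 4) [RLoad 4 3 4, RMul 3 3 4, RAdd 5 5 3, NAdd 4 4 6]))"

definition rate_prog :: com where
  "rate_prog = Seq (block (RMul 5 0 5) [RConst 3 4, RMul 3 3 0, RDiv 6 1 3])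
    (Cond (RLess 2 5) (block (RConst 3 0) [RSub 6 3 6]) skip)"

definition reweight_prog :: com where
  "reweight_prog = Seq (block (NConst 4 0) [RConst 5 0])
    (While (NLess 4 5) (block (RLoad 3 3 4)
      [RMul 3 6 3, RExp 3 3, RLoad 4 1 4, RMul 3 3 4, RStore 1 4 3, RAdd 5 5 3, NAdd 4 4 6]))"

definition normalize_prog :: com where
  "normalize_prog = Seq (Do (NConst 4 0))
    (While (NLess 4 5) (block (RLoad 3 1 4) [RDiv 3 3 5, RStore 1 4 3, NAdd 4 4 6]))"

definition mw_prog :: com where
  "mw_prog = Seq enum_prog (Seq ybar_prog (Seq dot_prog
    (Seq rate_prog (Seq reweight_prog normalize_prog))))"

section \<open>Loop invariants and correctness of the program\<close>

lemma subset_list_t_0: "subset_list m 0 = [{}]"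
  by (induction m) (simp_all add: subset_list_0 subset_list_Suc)

lemma subset_list_nth_subset:
  "j < binom_le m t \<Longrightarrow> subset_list m t ! j \<subseteq> {1..m}"
  using set_subset_list[of m t] nth_mem[of j "subset_list m t"]
  by (auto simp: length_subset_list subsets_le_def)

context
  fixes m t :: nat and W \<alpha> a :: real and p :: "coord \<Rightarrow> real" and y :: "nat \<Rightarrow> real"
begin

definition parr :: "nat \<Rightarrow> real" where
  "parr = (\<lambda>j. if j < dimN m t then p (coord_list m t ! j) else 0)"

definition consts_ok :: "store \<Rightarrow> bool" where
  "consts_ok s \<longleftrightarrow> nvar s 0 = m \<and> nvar s 1 = t \<and> nvar s 6 = 1 \<and> nvar s 7 = 0 \<and>
    rvar s 0 = W \<and> rvar s 1 = \<alpha> \<and> rvar s 2 = a"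

text \<open>That array 3 is still zero is recorded because slot 0 is never written and must read as
  \<open>ybar y Zero\<close>.\<close>

definition stores_sets :: "nat set list \<Rightarrow> store \<Rightarrow> bool" where
  "stores_sets l s \<longleftrightarrow> consts_ok s \<and> nvar s 3 = length l \<and>
    (\<forall>k<length l. narr s 0 k = card (l ! k) \<and> rarr s 2 k = (\<Prod>i\<in>l ! k. y i)) \<and>
    rarr s 0 = (\<lambda>i. if i \<in> {1..m} then y i else 0) \<and> rarr s 1 = parr \<and> rarr s 3 = (\<lambda>_. 0)"

definition extended :: "nat \<Rightarrow> nat \<Rightarrow> nat set list" where
  "extended i j = subset_list i t @
    map (insert (Suc i)) (filter (\<lambda>S. card S < t) (take j (subset_list i t)))"

text \<open>Here \<open>k\<close> counts the sets already tried and \<open>j\<close> is the loop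
  counter; they differ only between the conditional append and the increment.\<close>

definition extend_inv :: "nat \<Rightarrow> nat \<Rightarrow> nat \<Rightarrow> store \<Rightarrow> bool" where
  "extend_inv i k j s \<longleftrightarrow> stores_sets (extended i k) s \<and> nvar s 2 = Suc i \<and>
    nvar s 4 = j \<and> nvar s 5 = binom_le i t \<and> rvar s 3 = y (Suc i)"

lemma extended_Suc:
  assumes "j < binom_le i t"
  shows "extended i (Suc j) = (if card (subset_list i t ! j) < t
    then extended i j @ [insert (Suc i) (subset_list i t ! j)] else extended i j)"
  using assms by (simp add: extended_def length_subset_list take_Suc_conv_app_nth)

lemma extended_nth: "j < binom_le i t \<Longrightarrow> extended i k ! j = subset_list i t ! j"
  by (simp add: extended_def nth_append length_subset_list)

lemma length_extended: "binom_le i t \<le> length (extended i k)"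
  by (simp add: extended_def length_subset_list)

text \<open>Appending does not disturb the position being read, and as \<open>Suc i\<close> is
  fresh, the new cardinality and monomial cost one addition and one multiplication. The 9 units are
  the load, the test, at most six instructions, and the increment.\<close>

lemma extend_body_triple:
  assumes j: "j < binom_le i t"
  shows "triple \<kappa> (extend_inv i j j) extend_body 9 (extend_inv i (Suc j) (Suc j))"
proof -
  let ?S = "subset_list i t ! j"
  have S: "finite ?S" "Suc i \<notin> ?S"
    using subset_list_nth_subset[OF j] finite_subset by auto
  have jl: "j < length (extended i j)" using j length_extended[of i j] by simp
  let ?P = "\<lambda>s. extend_inv i j j s \<and> nvar s 8 = card ?S"
  have load: "triple \<kappa> (extend_inv i j j) (Do (NLoad 8 0 4)) 1 ?P"
    using jl j by (intro triple_Do)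
      (auto simp: extend_inv_def stores_sets_def consts_ok_def extended_nth)
  have add: "triple \<kappa> (\<lambda>s. ?P s \<and> run_test (NLess 8 1) s)
      (block (NAdd 8 8 6) [NStore 0 3 8, RLoad 4 2 4, RMul 4 4 3, RStore 2 3 4, NAdd 3 3 6])
      6 (extend_inv i (Suc j) j)"
    using jl j S
    by (intro triple_block)
      (auto simp: extend_inv_def stores_sets_def consts_ok_def extended_Suc extended_nth
          nth_append less_Suc_eq)
  have skip: "triple \<kappa> (\<lambda>s. ?P s \<and> \<not> run_test (NLess 8 1) s) skip 6 (extend_inv i (Suc j) j)"
    unfolding skip_def
    by (rule triple_weaken[OF triple_Do[where Q = "extend_inv i (Suc j) j"
          and P = "\<lambda>s. ?P s \<and> \<not> run_test (NLess 8 1) s"]])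
      (use j in \<open>auto simp: extend_inv_def stores_sets_def consts_ok_def extended_Suc\<close>)
  have incr: "triple \<kappa> (extend_inv i (Suc j) j) (Do (NAdd 4 4 6)) 1 (extend_inv i (Suc j) (Suc j))"
    by (intro triple_Do) (auto simp: extend_inv_def stores_sets_def consts_ok_def)
  show ?thesis
    unfolding extend_body_def
    using triple_Seq[OF load triple_Seq[OF triple_Cond[OF add skip] incr]] by simp
qed

definition enum_inv :: "nat \<Rightarrow> store \<Rightarrow> bool" where
  "enum_inv i s \<longleftrightarrow> stores_sets (subset_list i t) s \<and> nvar s 2 = i"

text \<open>The inner loop scans the \<open>binom_le i t\<close> old sets at 10 units each, at most
  \<open>binom_le m t\<close> of them. After the full scan \<open>extended\<close> is the right-hand
  side of \<open>subset_list_Suc\<close>.\<close>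

lemma enum_body_triple:
  assumes i: "i < m"
  shows "triple \<kappa> (enum_inv i) enum_body (10 * binom_le m t + 5) (enum_inv (Suc i))"
proof -
  have 1: "triple \<kappa> (enum_inv i) (block (NAdd 2 2 6) [RLoad 3 0 2, NAdd 5 3 7, NConst 4 0]) 4
      (extend_inv i 0 0)"
    using i
    by (intro triple_block)
      (auto simp: enum_inv_def extend_inv_def stores_sets_def consts_ok_def extended_def
          length_subset_list)
  have 2: "triple \<kappa> (extend_inv i 0 0) (While (NLess 4 5) extend_body)
      (binom_le i t * Suc 9 + 1) (extend_inv i (binom_le i t) (binom_le i t))"
    by (rule triple_For[where I = "\<lambda>j. extend_inv i j j", OF extend_body_triple])
      (auto simp: extend_inv_def)
  have "extended i (binom_le i t) = subset_list (Suc i) t"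
    by (simp add: extended_def subset_list_Suc length_subset_list[symmetric])
  then have "extend_inv i (binom_le i t) (binom_le i t) s \<Longrightarrow> enum_inv (Suc i) s" for s
    by (simp add: extend_inv_def enum_inv_def)
  then show ?thesis
    unfolding enum_body_def
    using i binom_le_mono[of i m t] by (intro triple_weaken[OF triple_Seq[OF 1 2]]) auto
qed

lemma enum_prog_triple:
  "triple \<kappa> (\<lambda>s. s = mw_input m t W \<alpha> p y a) enum_prog
    (binom_le m t * (10 * binom_le m t + 6) + 6) (stores_sets (subset_list m t))"
proof -
  let ?b = "binom_le m t * (10 * binom_le m t + 6) + 1"
  have init: "triple \<kappa> (\<lambda>s. s = mw_input m t W \<alpha> p y a)
      (block (NConst 6 1) [NConst 3 1, RConst 3 1, RStore 2 7 3]) 4 (enum_inv 0)"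
    by (intro triple_block)
      (auto simp: enum_inv_def stores_sets_def consts_ok_def mw_input_def subset_list_0 parr_def)
  have loop: "triple \<kappa> (\<lambda>s. enum_inv 0 s \<and> run_test (NLess 7 1) s) (While (NLess 2 0) enum_body)
      ?b (stores_sets (subset_list m t))"
  proof (cases "t > 0")
    case True
    have "triple \<kappa> (enum_inv 0) (While (NLess 2 0) enum_body)
        (m * Suc (10 * binom_le m t + 5) + 1) (enum_inv m)"
      by (rule triple_For[where I = enum_inv, OF enum_body_triple])
        (auto simp: enum_inv_def stores_sets_def consts_ok_def)
    then show ?thesis
      \<comment> \<open>Only here is the number \<open>m\<close> of outer iterations traded for
        \<open>binom_le m t\<close>, which requires \<open>t > 0\<close>.\<close>
      using mult_le_mono1[OF le_binom_le[OF True], of m "10 * binom_le m t + 6"]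
      by (elim triple_weaken) (auto simp: enum_inv_def add.commute)
  next
    case False
    \<comment> \<open>For \<open>t = 0\<close> the guard \<open>0 < t\<close> fails, so the
      precondition is unsatisfiable and the triple vacuous.\<close>
    have "nvar s 7 = 0 \<and> nvar s 1 = t" if "enum_inv 0 s" for s
      using that by (auto simp: enum_inv_def stores_sets_def consts_ok_def)
    with False have "\<not> (enum_inv 0 s \<and> run_test (NLess 7 1) s)" for s
      by fastforce
    then show ?thesis unfolding triple_def by blast
  qed
  \<comment> \<open>With \<open>t = 0\<close> the initial list \<open>[{}]\<close> is already the
    final one for every \<open>m\<close>.\<close>
  have "triple \<kappa> (\<lambda>s. enum_inv 0 s \<and> \<not> run_test (NLess 7 1) s) skip 1 (stores_sets (subset_list m t))"
    unfolding skip_def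
    by (rule triple_Do)
      (auto simp: enum_inv_def stores_sets_def consts_ok_def subset_list_0 subset_list_t_0)
  then have skip: "triple \<kappa> (\<lambda>s. enum_inv 0 s \<and> \<not> run_test (NLess 7 1) s) skip ?b
      (stores_sets (subset_list m t))"
    by (rule triple_weaken) auto
  show ?thesis
    unfolding enum_prog_def
    by (rule triple_weaken[OF triple_Seq[OF init triple_Cond[OF loop skip]]]) auto
qed

definition spread_inv :: "nat \<Rightarrow> store \<Rightarrow> bool" where
  "spread_inv j s \<longleftrightarrow> consts_ok s \<and> nvar s 3 = binom_le m t \<and> nvar s 4 = j \<and>
    (\<forall>k<binom_le m t. rarr s 2 k = (\<Prod>i\<in>subset_list m t ! k. y i)) \<and> rarr s 1 = parr \<and>
    rarr s 3 0 = 0 \<and> (\<forall>k<j. rarr s 3 (Suc k) = (\<Prod>i\<in>subset_list m t ! k. y i) \<and>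
      rarr s 3 (Suc (binom_le m t + k)) = - (\<Prod>i\<in>subset_list m t ! k. y i))"

definition ybar_ok :: "store \<Rightarrow> bool" where
  "ybar_ok s \<longleftrightarrow> (\<forall>k<dimN m t. rarr s 3 k = ybar y (coord_list m t ! k))"

lemma ybar_okI:
  assumes "spread_inv (binom_le m t) s"
  shows "ybar_ok s"
  unfolding ybar_ok_def
proof (intro allI impI)
  fix k assume "k < dimN m t"
  then consider "k = 0" | j where "k = Suc j" "j < binom_le m t"
    | j where "k = Suc (binom_le m t + j)" "j < binom_le m t"
  proof (cases k)
    case (Suc j)
    then show ?thesis
      using \<open>k < dimN m t\<close> that(2)[of j] that(3)[of "j - binom_le m t"]
      by (cases "j < binom_le m t") (auto simp: dimN_def)
  qed auto
  then show "rarr s 3 k = ybar y (coord_list m t ! k)"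
    using assms by cases (auto simp: spread_inv_def coord_list_nth)
qed

definition ready :: "store \<Rightarrow> bool" where
  "ready s \<longleftrightarrow> consts_ok s \<and> ybar_ok s \<and> rarr s 1 = parr"

lemma ybar_prog_triple:
  "triple \<kappa> (stores_sets (subset_list m t)) ybar_prog (8 * binom_le m t + 2)
    (\<lambda>s. ready s \<and> nvar s 3 = binom_le m t)"
proof -
  have init: "triple \<kappa> (stores_sets (subset_list m t)) (Do (NConst 4 0)) 1 (spread_inv 0)"
    by (rule triple_Do)
      (auto simp: stores_sets_def spread_inv_def consts_ok_def length_subset_list)
  have body: "triple \<kappa> (spread_inv j) (block (RLoad 4 2 4)
      [NAdd 4 4 6, RStore 3 4 4, RConst 3 0, RSub 4 3 4, NAdd 8 4 3, RStore 3 8 4]) 7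
      (spread_inv (Suc j))" if "j < binom_le m t" for j
    using that
    by (intro triple_block) (auto simp: spread_inv_def consts_ok_def less_Suc_eq)
  have loop: "triple \<kappa> (spread_inv 0) (While (NLess 4 3) (block (RLoad 4 2 4)
      [NAdd 4 4 6, RStore 3 4 4, RConst 3 0, RSub 4 3 4, NAdd 8 4 3, RStore 3 8 4]))
      (binom_le m t * Suc 7 + 1) (spread_inv (binom_le m t))"
    by (rule triple_For[where I = spread_inv, OF body]) (auto simp: spread_inv_def)
  show ?thesis
    unfolding ybar_prog_def
    by (rule triple_weaken[OF triple_Seq[OF init loop]])
      (auto simp: ready_def ybar_okI, auto simp: spread_inv_def)
qed

definition dot_inv :: "nat \<Rightarrow> store \<Rightarrow> bool" where
  "dot_inv j s \<longleftrightarrow> ready s \<and> nvar s 5 = dimN m t \<and> nvar s 4 = j \<and>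
    rvar s 5 = (\<Sum>k<j. p (coord_list m t ! k) * ybar y (coord_list m t ! k))"

lemma dot_prog_triple:
  "triple \<kappa> (\<lambda>s. ready s \<and> nvar s 3 = binom_le m t) dot_prog (6 * dimN m t + 5)
    (\<lambda>s. ready s \<and> nvar s 5 = dimN m t \<and> rvar s 5 = dot m t p (ybar y))"
proof -
  have init: "triple \<kappa> (\<lambda>s. ready s \<and> nvar s 3 = binom_le m t)
      (block (NAdd 5 3 3) [NAdd 5 5 6, NConst 4 0, RConst 5 0]) 4 (dot_inv 0)"
    by (intro triple_block) (auto simp: dot_inv_def ready_def consts_ok_def ybar_ok_def dimN_def)
  have body: "triple \<kappa> (dot_inv j)
      (block (RLoad 3 1 4) [RLoad 4 3 4, RMul 3 3 4, RAdd 5 5 3, NAdd 4 4 6]) 5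
      (dot_inv (Suc j))" if "j < dimN m t" for j
    using that
    by (intro triple_block) (auto simp: dot_inv_def ready_def consts_ok_def ybar_ok_def parr_def)
  have loop: "triple \<kappa> (dot_inv 0)
      (While (NLess 4 5) (block (RLoad 3 1 4) [RLoad 4 3 4, RMul 3 3 4, RAdd 5 5 3, NAdd 4 4 6]))
      (dimN m t * Suc 5 + 1) (dot_inv (dimN m t))"
    by (rule triple_For[where I = dot_inv, OF body]) (auto simp: dot_inv_def)
  show ?thesis
    unfolding dot_prog_def
    by (rule triple_weaken[OF triple_Seq[OF init loop]])
      (auto simp: dot_inv_def dot_def sum_coords_nth)
qed

text \<open>The sign of the update is moved from the vector \<open>r\<close> into the exponent
  factor, so the same array \<open>ybar y\<close> serves both cases.\<close>

definition rate :: real where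
  "rate = (if a < hyp_eval m t W p y then - (\<alpha> / (4 * W)) else \<alpha> / (4 * W))"

definition weight :: "nat \<Rightarrow> real" where
  "weight k = exp (rate * ybar y (coord_list m t ! k)) * p (coord_list m t ! k)"

lemma rate_prog_triple:
  "triple \<kappa> (\<lambda>s. ready s \<and> nvar s 5 = dimN m t \<and> rvar s 5 = dot m t p (ybar y)) rate_prog 7
    (\<lambda>s. ready s \<and> nvar s 5 = dimN m t \<and> rvar s 6 = rate)"
proof -
  let ?P = "\<lambda>s. ready s \<and> nvar s 5 = dimN m t \<and> rvar s 5 = dot m t p (ybar y)"
  let ?Q = "\<lambda>s. ready s \<and> nvar s 5 = dimN m t \<and> rvar s 5 = hyp_eval m t W p y \<and>
    rvar s 6 = \<alpha> / (4 * W)"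
  let ?R = "\<lambda>s. ready s \<and> nvar s 5 = dimN m t \<and> rvar s 6 = rate"
  have 1: "triple \<kappa> ?P (block (RMul 5 0 5) [RConst 3 4, RMul 3 3 0, RDiv 6 1 3]) 4 ?Q"
    by (intro triple_block) (auto simp: ready_def consts_ok_def ybar_ok_def hyp_eval_def)
  have 2: "triple \<kappa> (\<lambda>s. ?Q s \<and> run_test (RLess 2 5) s) (block (RConst 3 0) [RSub 6 3 6]) 2 ?R"
    by (intro triple_block) (auto simp: ready_def consts_ok_def ybar_ok_def rate_def)
  have "triple \<kappa> (\<lambda>s. ?Q s \<and> \<not> run_test (RLess 2 5) s) skip 1 ?R"
    unfolding skip_def
    by (rule triple_Do) (auto simp: ready_def consts_ok_def ybar_ok_def rate_def)
  then have 3: "triple \<kappa> (\<lambda>s. ?Q s \<and> \<not> run_test (RLess 2 5) s) skip 2 ?R"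
    by (rule triple_weaken) auto
  show ?thesis
    unfolding rate_prog_def using triple_Seq[OF 1 triple_Cond[OF 2 3]] by simp
qed

text \<open>The hypothesis is overwritten in place, so \<open>ready\<close> need not hold any more.
  The normalizer is accumulated in the same pass.\<close>

definition reweight_inv :: "nat \<Rightarrow> store \<Rightarrow> bool" where
  "reweight_inv j s \<longleftrightarrow> nvar s 6 = 1 \<and> nvar s 5 = dimN m t \<and> nvar s 4 = j \<and> ybar_ok s \<and>
    rvar s 6 = rate \<and> rvar s 5 = (\<Sum>k<j. weight k) \<and>
    (\<forall>k<dimN m t. rarr s 1 k = (if k < j then weight k else p (coord_list m t ! k)))"

lemma reweight_prog_triple:
  "triple \<kappa> (\<lambda>s. ready s \<and> nvar s 5 = dimN m t \<and> rvar s 6 = rate) reweight_prog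
    (9 * dimN m t + 3) (reweight_inv (dimN m t))"
proof -
  let ?P = "\<lambda>s. ready s \<and> nvar s 5 = dimN m t \<and> rvar s 6 = rate"
  let ?is = "[RMul 3 6 3, RExp 3 3, RLoad 4 1 4, RMul 3 3 4, RStore 1 4 3, RAdd 5 5 3, NAdd 4 4 6]"
  have init: "triple \<kappa> ?P (block (NConst 4 0) [RConst 5 0]) 2 (reweight_inv 0)"
    by (intro triple_block)
      (auto simp: reweight_inv_def ready_def consts_ok_def ybar_ok_def parr_def)
  have body: "triple \<kappa> (reweight_inv j) (block (RLoad 3 3 4) ?is) 8 (reweight_inv (Suc j))"
    if "j < dimN m t" for j
    using that
    by (intro triple_block) (auto simp: reweight_inv_def ybar_ok_def weight_def)
  have loop: "triple \<kappa> (reweight_inv 0) (While (NLess 4 5) (block (RLoad 3 3 4) ?is))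
      (dimN m t * Suc 8 + 1) (reweight_inv (dimN m t))"
    by (rule triple_For[where I = reweight_inv, OF body]) (auto simp: reweight_inv_def)
  show ?thesis
    unfolding reweight_prog_def
    by (rule triple_weaken[OF triple_Seq[OF init loop]]) auto
qed

definition normalize_inv :: "nat \<Rightarrow> store \<Rightarrow> bool" where
  "normalize_inv j s \<longleftrightarrow> nvar s 6 = 1 \<and> nvar s 5 = dimN m t \<and> nvar s 4 = j \<and>
    rvar s 5 = (\<Sum>k<dimN m t. weight k) \<and>
    (\<forall>k<dimN m t. rarr s 1 k =
      (if k < j then weight k / (\<Sum>k<dimN m t. weight k) else weight k))"

lemma normalize_prog_triple:
  "triple \<kappa> (reweight_inv (dimN m t)) normalize_prog (5 * dimN m t + 2)
    (normalize_inv (dimN m t))"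
proof -
  let ?is = "[RDiv 3 3 5, RStore 1 4 3, NAdd 4 4 6]"
  have init: "triple \<kappa> (reweight_inv (dimN m t)) (Do (NConst 4 0)) 1 (normalize_inv 0)"
    by (rule triple_Do) (auto simp: reweight_inv_def normalize_inv_def)
  have body: "triple \<kappa> (normalize_inv j) (block (RLoad 3 1 4) ?is) 4 (normalize_inv (Suc j))"
    if "j < dimN m t" for j
    using that
    by (intro triple_block) (auto simp: normalize_inv_def)
  have loop: "triple \<kappa> (normalize_inv 0) (While (NLess 4 5) (block (RLoad 3 1 4) ?is))
      (dimN m t * Suc 4 + 1) (normalize_inv (dimN m t))"
    by (rule triple_For[where I = normalize_inv, OF body]) (auto simp: normalize_inv_def)
  show ?thesis
    unfolding normalize_prog_def
    by (rule triple_weaken[OF triple_Seq[OF init loop]]) auto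
qed

text \<open>Nonnegativity of \<open>p\<close> removes the absolute values from the norm, so the
  plain sum accumulated by the program is the right divisor.\<close>

lemma mw_update_nth:
  assumes "\<And>I. I \<in> coords m t \<Longrightarrow> p I \<ge> 0" and k: "k < dimN m t"
  shows "mw_update m t W \<alpha> p y a (coord_list m t ! k) = weight k / (\<Sum>k<dimN m t. weight k)"
proof -
  define w where "w I = exp (rate * ybar y I) * p I" for I
  have in_coords: "coord_list m t ! j \<in> coords m t" if "j < dimN m t" for j
    using that set_coord_list[of m t] by (metis length_coord_list nth_mem)
  have "mw_update m t W \<alpha> p y a = (\<lambda>I\<in>coords m t. w I / l1_norm m t w)"
    unfolding mw_update_def Let_def w_def rate_def by (auto simp: fun_eq_iff)
  moreover have "l1_norm m t w = (\<Sum>k<dimN m t. weight k)"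
    unfolding l1_norm_def sum_coords_nth
    using assms(1)[OF in_coords] by (intro sum.cong) (auto simp: w_def weight_def abs_mult)
  ultimately show ?thesis
    using in_coords[OF k] by (simp add: w_def weight_def)
qed

lemma mw_prog_triple:
  assumes "\<And>I. I \<in> coords m t \<Longrightarrow> p I \<ge> 0"
  shows "triple \<kappa> (\<lambda>s. s = mw_input m t W \<alpha> p y a) mw_prog (200 * (binom_le m t)\<^sup>2)
    (mw_output m t (mw_update m t W \<alpha> p y a))"
proof -
  \<comment> \<open>With \<open>b\<close> for \<open>binom_le m t\<close> and \<open>c\<close> for
    its square, the phases add up to \<open>10 * c + 54 * b + 45\<close>; the constant 200 is
    generous.\<close>
  have arith: "10 * c + 6 * b + 6 + (8 * b + 2 + (6 * (2 * b + 1) + 5 + (7 +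
      (9 * (2 * b + 1) + 3 + (5 * (2 * b + 1) + 2))))) \<le> 200 * c" if "1 \<le> c" "b \<le> c" for b c :: nat
    using that by simp
  have "1 \<le> binom_le m t" using binom_le_pos[of m t] by simp
  then have "1 \<le> (binom_le m t)\<^sup>2" "binom_le m t \<le> (binom_le m t)\<^sup>2"
    by (auto simp: power2_eq_square)
  note arith[OF this]
  moreover have "binom_le m t * (10 * binom_le m t + 6) = 10 * (binom_le m t)\<^sup>2 + 6 * binom_le m t"
    by (simp add: power2_eq_square distrib_left)
  ultimately have bound: "binom_le m t * (10 * binom_le m t + 6) + 6 + (8 * binom_le m t + 2 +
    (6 * dimN m t + 5 + (7 + (9 * dimN m t + 3 + (5 * dimN m t + 2))))) \<le> 200 * (binom_le m t)\<^sup>2"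
    unfolding dimN_def by (simp only:)
  show ?thesis
    unfolding mw_prog_def
  proof (rule triple_weaken[OF triple_Seq[OF enum_prog_triple triple_Seq[OF ybar_prog_triple
          triple_Seq[OF dot_prog_triple triple_Seq[OF rate_prog_triple
          triple_Seq[OF reweight_prog_triple normalize_prog_triple]]]]] _ _ bound])
    fix s assume "normalize_inv (dimN m t) s"
    then show "mw_output m t (mw_update m t W \<alpha> p y a) s"
      using mw_update_nth[OF assms] by (simp add: mw_output_def normalize_inv_def)
  qed
qed

end

section \<open>Polynomial running time\<close>

lemma poly_bounded_mult_binom_le:
  assumes "poly_bounded \<kappa>"
  shows "poly_bounded (\<lambda>m t W \<alpha>. Suc (\<kappa> m t W \<alpha>) * (C * (binom_le m t)\<^sup>2))"
proof -
  obtain c k where ck: "\<And>m t W \<alpha>. W > 0 \<Longrightarrow> \<alpha> > 0 \<Longrightarrow>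
      real (\<kappa> m t W \<alpha>) \<le> c * (1 + real (binom_le m t) + max 0 (ln W) + max 0 (ln (1 / \<alpha>))) ^ k"
    using assms unfolding poly_bounded_def by blast
  show ?thesis
    unfolding poly_bounded_def
  proof (intro exI allI impI)
    fix m t and W \<alpha> :: real assume pos: "W > 0" "\<alpha> > 0"
    define x where "x = 1 + real (binom_le m t) + max 0 (ln W) + max 0 (ln (1 / \<alpha>))"
    have x: "1 \<le> x" "real (binom_le m t) \<le> x" unfolding x_def by auto
    \<comment> \<open>Since \<open>x \<ge> 1\<close>, raising the coefficient by 1 absorbs the
      successor.\<close>
    have "real (Suc (\<kappa> m t W \<alpha>)) \<le> (c + 1) * x ^ k"
      using ck[OF pos, of m t, folded x_def] one_le_power[OF x(1), of k] by (simp add: distrib_right)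
    moreover have "real (C * (binom_le m t)\<^sup>2) \<le> C * x\<^sup>2"
      using x by (simp add: mult_left_mono power_mono)
    \<comment> \<open>The sign of \<open>c\<close> is unknown; the upper bound on the first factor
      is nonnegative because it dominates a natural number.\<close>
    ultimately have "real (Suc (\<kappa> m t W \<alpha>)) * real (C * (binom_le m t)\<^sup>2)
        \<le> (c + 1) * x ^ k * (C * x\<^sup>2)"
      by (intro mult_mono) (auto intro: order_trans[of 0 "real (Suc (\<kappa> m t W \<alpha>))"])
    also have "\<dots> = (c + 1) * C * x ^ (k + 2)"
      by (simp add: power_add power2_eq_square)
    finally show "real (Suc (\<kappa> m t W \<alpha>) * (C * (binom_le m t)\<^sup>2)) \<le>
        (c + 1) * C * (1 + real (binom_le m t) + max 0 (ln W) + max 0 (ln (1 / \<alpha>))) ^ (k + 2)"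
      unfolding x_def of_nat_mult by simp
  qed
qed

text \<open>The triples hold for every operation cost, so one program serves all \<kappa>; the cost
  enters only through the time bound.\<close>

lemma mw_update_poly_time: "runs_in_poly_time mw_update"
  unfolding runs_in_poly_time_def
proof (intro exI[of _ mw_prog] allI impI)
  fix \<kappa> :: "nat \<Rightarrow> nat \<Rightarrow> real \<Rightarrow> real \<Rightarrow> nat"
  assume "poly_bounded \<kappa>"
  let ?T = "\<lambda>m t W \<alpha>. Suc (\<kappa> m t W \<alpha>) * (200 * (binom_le m t)\<^sup>2)"
  have "\<exists>n s. exec (\<kappa> m t W \<alpha>) mw_prog (mw_input m t W \<alpha> p y a) n s \<and>
      n \<le> ?T m t W \<alpha> \<and> mw_output m t (mw_update m t W \<alpha> p y a) s"
    if "p \<in> hypotheses m t" for m t W \<alpha> p y a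
  proof -
    have "p I \<ge> 0" if "I \<in> coords m t" for I
      using \<open>p \<in> hypotheses m t\<close> that by (auto simp: hypotheses_def)
    from mw_prog_triple[of m t p "\<kappa> m t W \<alpha>" W \<alpha> y a, OF this] show ?thesis
      unfolding triple_def by blast
  qed
  then show "\<exists>T. poly_bounded T \<and>
      (\<forall>m t W \<alpha>. W > 0 \<longrightarrow> \<alpha> > 0 \<longrightarrow> (\<forall>p\<in>hypotheses m t. \<forall>y\<in>cube m. \<forall>a.
        \<exists>n s. exec (\<kappa> m t W \<alpha>) mw_prog (mw_input m t W \<alpha> p y a) n s \<and>
          n \<le> T m t W \<alpha> \<and> mw_output m t (mw_update m t W \<alpha> p y a) s))"
    using poly_bounded_mult_binom_le[OF \<open>poly_bounded \<kappa>\<close>] by blast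
qed

theorem theorem3p5:
  fixes \<alpha> W :: real and m t :: nat
    and X :: "'x set"
    and Y :: "(nat \<Rightarrow> real) set"
    and q :: "(nat \<Rightarrow> real) \<Rightarrow> 'x \<Rightarrow> real"
  assumes "\<alpha> > 0" and "W > 0"
    and "Y \<subseteq> cube m"
    and "\<And>y. y \<in> Y \<Longrightarrow> counting_query X (q y)"
    and "approximates m (bounded_polys t W m) (\<alpha> / 4) X Y q"
  shows "is_IDC (hyp_eval m t W) (mw_init m t) (mw_update m t W \<alpha>) X Y q \<alpha>
           (16 * W\<^sup>2 * ln (2 * real (binom_le m t) + 1) / \<alpha>\<^sup>2)
         \<and> runs_in_poly_time mw_update"
  using mw_is_IDC[OF assms(1-3,5)] mw_update_poly_time by blast

end
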